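(* Let $E=\mathrm{ind}_m E_m$ be an LF-space with stepwise Schauder basis $(e_j)_{j\in\mathbb{N}}$ and associated backward shift $B$. Then the following are equivalent. (i) $B$ is sequentially hypercyclic on $E$. (ii) $B$ is hypercyclic on $E$. (iii) There are $m\in\mathbb{N}$ and a thick set $I\subseteq\mathbb{N}$ such that $\lim_{I\ni j\to\infty}e_j=0$ in $E_m$.
   Context: $\mathbb{N}=\{1,2,\dots\}$, and $\mathbb{K}\in\{\mathbb{R},\mathbb{C}\}$ is the scalar field. LF-space: an inductive spectrum of Fréchet spaces $(E_m)_{m\in\mathbb{N}}$ is an increasing sequence of Fréchet spaces such that each inclusion $E_m\subset E_{m+1}$ is continuous. Its inductive limit (LF-space) $E=\mathrm{ind}_m E_m$ is the union $\bigcup_m E_m$ with the finest locally convex topology making every inclusion $E_m\subset E$ continuous; this topology is assumed to be Hausdorff. Stepwise Schauder basis: a sequence $(e_j)_{j\in\mathbb{N}}$ in $E_1$ which is a Schauder basis of $E_m$ for every $m\in\mathbb{N}$. Associated backward shift: if the linear map on $\mathrm{span}\{e_j: j\in\mathbb{N}\}$ given by $Be_1:=0$, $Be_j:=e_{j-1}$ for $j\ge 2$, extends to a continuous linear map $B:E\to E$, then $B$ is called the backward shift associated with $(e_j)_j$. Saying that $E$ has associated backward shift $B$ means that this continuous extension exists. A continuous linear operator $T$ on $E$ is hypercyclic (resp. sequentially hypercyclic) if there is $x\in E$ whose orbit $\{x,Tx,T^2x,\dots\}$ is dense (resp. sequentially dense) in $E$. A set $A\subseteq E$ is sequentially dense if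 every element of $E$ is the limit of a sequence in $A$. A set $I\subseteq\mathbb{N}$ is thick if for every $p\in\mathbb{N}$ there is $j\in\mathbb{N}$ with $\{j,j+1,\dots,j+p\}\subseteq I$. The notation $\lim_{I\ni j\to\infty}$ means the limit as $j\to\infty$ with $j$ restricted to $I$. *)

theory Defs
  imports "HOL-Analysis.Analysis"
begin

text \<open>
  Conventions. All spaces are linear subspaces of one ambient vector space \<open>'a\<close> with scalar
  multiplication \<open>smul\<close>; a topological vector space is given by a topology \<open>T\<close> on \<open>'a\<close>, with
  underlying set \<open>topspace T\<close>. A type of class \<open>{real_normed_field, euclidean_space}\<close>
  is a finite-dimensional real field extension with multiplicative norm, i.e. the real or the
  complex numbers; both types are instances.
  Sequences are indexed from 0, so \<open>e j\<close> and \<open>F m\<close> stand for $e_{j+1}$ and $E_{m+1}$.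
\<close>

definition topological_vector_space ::
    "('k::real_normed_field \<Rightarrow> 'a::ab_group_add \<Rightarrow> 'a) \<Rightarrow> 'a topology \<Rightarrow> bool" where
  "topological_vector_space smul T \<longleftrightarrow>
     module.subspace smul (topspace T) \<and>
     continuous_map (prod_topology T T) T (\<lambda>(x, y). x + y) \<and>
     continuous_map (prod_topology euclidean T) T (\<lambda>(c, x). smul c x)"

definition convex_wrt ::
    "('k::real_normed_field \<Rightarrow> 'a::ab_group_add \<Rightarrow> 'a) \<Rightarrow> 'a set \<Rightarrow> bool" where
  "convex_wrt smul V \<longleftrightarrow>
     (\<forall>x\<in>V. \<forall>y\<in>V. \<forall>t::real. 0 \<le> t \<and> t \<le> 1 \<longrightarrow>
        smul (of_real (1 - t)) x + smul (of_real t) y \<in> V)"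

text \<open>Local convexity does not include the Hausdorff property.\<close>

definition locally_convex_space ::
    "('k::real_normed_field \<Rightarrow> 'a::ab_group_add \<Rightarrow> 'a) \<Rightarrow> 'a topology \<Rightarrow> bool" where
  "locally_convex_space smul T \<longleftrightarrow>
     topological_vector_space smul T \<and>
     (\<forall>U. openin T U \<and> 0 \<in> U \<longrightarrow>
        (\<exists>V. openin T V \<and> 0 \<in> V \<and> V \<subseteq> U \<and> convex_wrt smul V))"

definition frechet_space ::
    "('k::real_normed_field \<Rightarrow> 'a::ab_group_add \<Rightarrow> 'a) \<Rightarrow> 'a topology \<Rightarrow> bool" where
  "frechet_space smul T \<longleftrightarrow>
     locally_convex_space smul T \<and>
     (\<exists>d. mspace d = topspace T \<and> mtopology_of d = T \<and> mcomplete_of d \<and>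
        (\<forall>x\<in>topspace T. \<forall>y\<in>topspace T. \<forall>z\<in>topspace T.
           mdist d (x + z) (y + z) = mdist d x y))"

definition inductive_spectrum ::
    "('k::real_normed_field \<Rightarrow> 'a::ab_group_add \<Rightarrow> 'a) \<Rightarrow> (nat \<Rightarrow> 'a topology) \<Rightarrow> bool" where
  "inductive_spectrum smul F \<longleftrightarrow>
     (\<forall>m. frechet_space smul (F m)) \<and>
     (\<forall>m. topspace (F m) \<subseteq> topspace (F (Suc m)) \<and>
          continuous_map (F m) (F (Suc m)) (\<lambda>x. x))"

text \<open>The locally convex topologies on the union of the steps that compete for being the finest.\<close>

definition admissible_topology ::
    "('k::real_normed_field \<Rightarrow> 'a::ab_group_add \<Rightarrow> 'a) \<Rightarrow> (nat \<Rightarrow> 'a topology)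
      \<Rightarrow> 'a topology \<Rightarrow> bool" where
  "admissible_topology smul F T \<longleftrightarrow>
     topspace T = (\<Union>m. topspace (F m)) \<and>
     locally_convex_space smul T \<and>
     (\<forall>m. continuous_map (F m) T (\<lambda>x. x))"

definition inductive_limit ::
    "('k::real_normed_field \<Rightarrow> 'a::ab_group_add \<Rightarrow> 'a) \<Rightarrow> (nat \<Rightarrow> 'a topology)
      \<Rightarrow> 'a topology \<Rightarrow> bool" where
  "inductive_limit smul F T \<longleftrightarrow>
     admissible_topology smul F T \<and>
     (\<forall>T'. admissible_topology smul F T' \<longrightarrow> (\<forall>U. openin T' U \<longrightarrow> openin T U))"

definition lf_space ::
    "('k::real_normed_field \<Rightarrow> 'a::ab_group_add \<Rightarrow> 'a) \<Rightarrow> (nat \<Rightarrow> 'a topology)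
      \<Rightarrow> 'a topology \<Rightarrow> bool" where
  "lf_space smul F T \<longleftrightarrow>
     inductive_spectrum smul F \<and> inductive_limit smul F T \<and> Hausdorff_space T"

definition schauder_basis ::
    "('k::real_normed_field \<Rightarrow> 'a::ab_group_add \<Rightarrow> 'a) \<Rightarrow> 'a topology \<Rightarrow> (nat \<Rightarrow> 'a) \<Rightarrow> bool" where
  "schauder_basis smul T e \<longleftrightarrow>
     (\<forall>j. e j \<in> topspace T) \<and>
     (\<forall>x\<in>topspace T. \<exists>!c::nat \<Rightarrow> 'k.
        limitin T (\<lambda>n. \<Sum>j<n. smul (c j) (e j)) x sequentially)"

definition stepwise_schauder_basis ::
    "('k::real_normed_field \<Rightarrow> 'a::ab_group_add \<Rightarrow> 'a) \<Rightarrow> (nat \<Rightarrow> 'a topology)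
      \<Rightarrow> (nat \<Rightarrow> 'a) \<Rightarrow> bool" where
  "stepwise_schauder_basis smul F e \<longleftrightarrow>
     (\<forall>j. e j \<in> topspace (F 0)) \<and> (\<forall>m. schauder_basis smul (F m) e)"

definition continuous_linear_operator ::
    "('k::real_normed_field \<Rightarrow> 'a::ab_group_add \<Rightarrow> 'a) \<Rightarrow> 'a topology \<Rightarrow> ('a \<Rightarrow> 'a) \<Rightarrow> bool" where
  "continuous_linear_operator smul T A \<longleftrightarrow>
     continuous_map T T A \<and>
     (\<forall>x\<in>topspace T. \<forall>y\<in>topspace T. A (x + y) = A x + A y) \<and>
     (\<forall>c. \<forall>x\<in>topspace T. A (smul c x) = smul c (A x))"

text \<open>
  A linear operator extends the shift on the span of the \<open>e j\<close> iff it has the prescribed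
  values on the \<open>e j\<close>. Values of \<open>B\<close> outside \<open>topspace T\<close> are irrelevant.
\<close>

definition associated_backward_shift ::
    "('k::real_normed_field \<Rightarrow> 'a::ab_group_add \<Rightarrow> 'a) \<Rightarrow> 'a topology \<Rightarrow> (nat \<Rightarrow> 'a)
      \<Rightarrow> ('a \<Rightarrow> 'a) \<Rightarrow> bool" where
  "associated_backward_shift smul T e B \<longleftrightarrow>
     continuous_linear_operator smul T B \<and> B (e 0) = 0 \<and> (\<forall>j. B (e (Suc j)) = e j)"

definition dense_in :: "'a topology \<Rightarrow> 'a set \<Rightarrow> bool" where
  "dense_in T A \<longleftrightarrow> A \<subseteq> topspace T \<and> T closure_of A = topspace T"

definition sequentially_dense_in :: "'a topology \<Rightarrow> 'a set \<Rightarrow> bool" where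
  "sequentially_dense_in T A \<longleftrightarrow>
     A \<subseteq> topspace T \<and>
     (\<forall>y\<in>topspace T. \<exists>s::nat \<Rightarrow> 'a. (\<forall>n. s n \<in> A) \<and> limitin T s y sequentially)"

definition orbit_of :: "('a \<Rightarrow> 'a) \<Rightarrow> 'a \<Rightarrow> 'a set" where
  "orbit_of A x = range (\<lambda>n. (A ^^ n) x)"

definition hypercyclic :: "'a topology \<Rightarrow> ('a \<Rightarrow> 'a) \<Rightarrow> bool" where
  "hypercyclic T A \<longleftrightarrow> (\<exists>x\<in>topspace T. dense_in T (orbit_of A x))"

definition sequentially_hypercyclic :: "'a topology \<Rightarrow> ('a \<Rightarrow> 'a) \<Rightarrow> bool" where
  "sequentially_hypercyclic T A \<longleftrightarrow> (\<exists>x\<in>topspace T. sequentially_dense_in T (orbit_of A x))"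

definition thick :: "nat set \<Rightarrow> bool" where
  "thick I \<longleftrightarrow> (\<forall>p. \<exists>j. {j..j + p} \<subseteq> I)"

end

theory Submission
  imports Defs
begin

text \<open>
  Sequential density implies density, so two implications remain.

  Suppose that \<open>x\<close> has dense orbit, and let \<open>F m\<close> be a step that contains \<open>x\<close>. Shifting by \<open>n\<close> moves
  the coordinate with index \<open>n + j\<close> to the index \<open>j\<close>. If the coordinate functionals are continuous on the
  LF-space, density yields for each \<open>p\<close> some \<open>n\<close> for which the coordinates of \<open>x\<close> at \<open>n, \<dots>, n + p\<close> are
  within 1/2 of 1. Thus the set \<open>I\<close> of all \<open>j\<close> with \<open>\<bar>x\<^sub>j\<bar> \<ge> 1/2\<close> is thick. The terms \<open>x\<^sub>j e\<^sub>j\<close> of the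
  expansion tend to 0 in \<open>F m\<close>, and dividing by \<open>x\<^sub>j\<close> gives \<open>e\<^sub>j \<rightarrow> 0\<close> along \<open>I\<close>
  (\<open>hypercyclic_imp_thick\<close>). Continuity of the coordinates on a single step is Banach's theorem
  (\<open>coef_continuous\<close>): by Baire's theorem, completeness and the closedness of lines, the balls of
  the F-norm given by the supremum over all partial sums are neighbourhoods of 0. Continuity passes to the
  inductive limit because the initial topology of a linear functional is locally convex
  (\<open>coord_continuous\<close>).

  Conversely, let \<open>e\<^sub>j \<rightarrow> 0\<close> in \<open>F m\<close> along a thick set. Take a sequence \<open>Y\<^sub>k\<close> of finite linear combinations
  of the basis that runs infinitely often through a countable set dense in every step, and let \<open>x\<close> be the
  sum of the forward shifts of the \<open>Y\<^sub>k\<close> by \<open>n\<^sub>k\<close>. Thickness permits choosing \<open>n\<^sub>k\<close> such that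
  the forward shift of \<open>Y\<^sub>k\<close> by \<open>n\<^sub>k\<close>, and also those by \<open>n\<^sub>k - n\<^sub>i\<close> for all \<open>i < k\<close>, have F-norm at
  most \<open>2\<close> to the power \<open>-k\<close> in \<open>F m\<close>. Then \<open>B\<close> to the power \<open>n\<^sub>k\<close> maps \<open>x\<close> to \<open>Y\<^sub>k + r\<^sub>k\<close> with
  \<open>r\<^sub>k \<rightarrow> 0\<close> in \<open>F m\<close> (\<open>approximating_orbit\<close>), and every vector is the limit, in some step, of terms
  of this sequence whose indices \<open>k\<close> tend to infinity.
\<close>

section \<open>Complete F-norms\<close>

text \<open>
  A complete F-norm \<open>f\<close> on a subspace \<open>X\<close>: the function \<open>x \<mapsto> d(x, 0)\<close> for a complete
  translation-invariant metric \<open>d\<close> on \<open>X\<close> that makes \<open>X\<close> a topological vector space. Nonnegativity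
  and symmetry are required on the whole type, so that \<open>f (x - y)\<close> is a metric in the sense of
  the locale \<^locale>\<open>Metric_space\<close>. The last two conditions before completeness
  are the continuity of scalar multiplication at \<open>(0, x)\<close> and at \<open>(0, 0)\<close>.
\<close>

locale f_space = vector_space smul
  for smul :: "'k::{real_normed_field, euclidean_space} \<Rightarrow> 'a::ab_group_add \<Rightarrow> 'a" +
  fixes X :: "'a set" and f :: "'a \<Rightarrow> real"
  assumes sub: "subspace X"
    and f_nonneg: "0 \<le> f x"
    and f_minus: "f (- x) = f x"
    and f_eq_0: "x \<in> X \<Longrightarrow> f x = 0 \<longleftrightarrow> x = 0"
    and f_add: "x \<in> X \<Longrightarrow> y \<in> X \<Longrightarrow> f (x + y) \<le> f x + f y"
    and f_scale_vec: "x \<in> X \<Longrightarrow> 0 < \<epsilon> \<Longrightarrow> \<exists>r>0. \<forall>c. norm c < r \<longrightarrow> f (smul c x) < \<epsilon>"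
    and f_scale_0: "0 < \<epsilon> \<Longrightarrow>
      \<exists>r>0. \<exists>\<delta>>0. \<forall>c. \<forall>x\<in>X. norm c < r \<longrightarrow> f x < \<delta> \<longrightarrow> f (smul c x) < \<epsilon>"
    and f_complete: "\<And>s::nat \<Rightarrow> 'a. (\<And>n. s n \<in> X) \<Longrightarrow>
      (\<And>\<epsilon>. 0 < \<epsilon> \<Longrightarrow> \<exists>N. \<forall>m\<ge>N. \<forall>n\<ge>N. f (s m - s n) < \<epsilon>) \<Longrightarrow>
      \<exists>x\<in>X. (\<lambda>n. f (s n - x)) \<longlonglongrightarrow> 0"
begin

lemma mem [simp, intro]:
  "0 \<in> X" "x \<in> X \<Longrightarrow> y \<in> X \<Longrightarrow> x + y \<in> X" "x \<in> X \<Longrightarrow> y \<in> X \<Longrightarrow> x - y \<in> X"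
  "x \<in> X \<Longrightarrow> smul c x \<in> X" "x \<in> X \<Longrightarrow> - x \<in> X"
  using sub by (auto intro: subspace_0 subspace_add subspace_diff subspace_scale subspace_neg)

lemma mem_sum [intro]: "(\<And>i. i \<in> A \<Longrightarrow> g i \<in> X) \<Longrightarrow> sum g A \<in> X"
  using sub by (rule subspace_sum)

lemma f_0 [simp]: "f 0 = 0"
  using f_eq_0[of 0] by simp

lemma f_commute: "f (x - y) = f (y - x)"
  using f_minus[of "x - y"] by simp

lemma f_tendsto_0I:
  assumes "\<And>\<epsilon>. 0 < \<epsilon> \<Longrightarrow> \<forall>\<^sub>F n in G. f (s n) < \<epsilon>"
  shows "((\<lambda>n. f (s n)) \<longlongrightarrow> 0) G"
  unfolding tendsto_iff using assms by (simp add: f_nonneg)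

lemma f_diff: "x \<in> X \<Longrightarrow> y \<in> X \<Longrightarrow> f (x - y) \<le> f x + f y"
  using f_add[of x "- y"] by (simp add: f_minus)

lemma f_triangle: "x \<in> X \<Longrightarrow> y \<in> X \<Longrightarrow> z \<in> X \<Longrightarrow> f (x - z) \<le> f (x - y) + f (y - z)"
  using f_add[of "x - y" "y - z"] by simp

lemma f_le_diff: "x \<in> X \<Longrightarrow> y \<in> X \<Longrightarrow> f x \<le> f y + f (x - y)"
  using f_add[of y "x - y"] by simp

lemma f_sum: "(\<And>i. i \<in> A \<Longrightarrow> g i \<in> X) \<Longrightarrow> f (sum g A) \<le> (\<Sum>i\<in>A. f (g i))"
proof (induction A rule: infinite_finite_induct)
  case (insert i A)
  have "f (g i + sum g A) \<le> f (g i) + f (sum g A)"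
    using insert.prems by (intro f_add mem_sum) auto
  with insert show ?case by fastforce
qed auto

lemma f_of_nat: "x \<in> X \<Longrightarrow> f (smul (of_nat n) x) \<le> real n * f x"
proof (induction n)
  case (Suc n)
  have "f (smul (of_nat (Suc n)) x) = f (x + smul (of_nat n) x)"
    by (simp add: scale_left_distrib)
  also have "\<dots> \<le> f x + f (smul (of_nat n) x)"
    using Suc.prems by (intro f_add) auto
  finally show ?case using Suc by (simp add: algebra_simps)
qed simp

text \<open>Multiplication by scalars of norm at most \<open>K\<close> is equicontinuous at 0.\<close>

lemma scale_bounded:
  assumes "0 < \<epsilon>"
  shows "\<exists>\<delta>>0. \<forall>c. \<forall>x\<in>X. norm c \<le> K \<longrightarrow> f x < \<delta> \<longrightarrow> f (smul c x) < \<epsilon>"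
proof -
  obtain r \<delta> where r: "0 < r" "0 < \<delta>"
    and *: "\<And>c x. x \<in> X \<Longrightarrow> norm c < r \<Longrightarrow> f x < \<delta> \<Longrightarrow> f (smul c x) < \<epsilon>"
    using f_scale_0[OF assms] by metis
  obtain n0 where n0: "K / r < real n0" using reals_Archimedean2 by blast
  define n where "n = Suc n0"
  have n: "K / real n < r" "0 < real n"
    using n0 r by (auto simp: n_def field_simps)
  \<comment> \<open>Write \<open>c x = (c / n) (n x)\<close>, where \<open>c / n\<close> is small and \<open>f (n x) \<le> n f x\<close>.\<close>
  have "f (smul c x) < \<epsilon>" if "norm c \<le> K" "x \<in> X" "f x < \<delta> / real n" for c x
  proof -
    have "norm (c / of_nat n) = norm c / real n"
      by (simp add: norm_divide)
    also have "\<dots> \<le> K / real n"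
      using that n by (simp add: divide_right_mono)
    finally have 1: "norm (c / of_nat n) < r" using n by linarith
    have "f (smul (of_nat n) x) \<le> real n * f x" using that by (simp add: f_of_nat)
    also have "\<dots> < \<delta>" using that n by (simp add: field_simps)
    finally have "f (smul (c / of_nat n) (smul (of_nat n) x)) < \<epsilon>"
      using * 1 that by blast
    moreover have "(of_nat n :: 'k) \<noteq> 0" using n by simp
    ultimately show ?thesis by simp
  qed
  moreover have "0 < \<delta> / real n" using r n by simp
  ultimately show ?thesis by blast
qed

lemma f_limit_unique:
  assumes "x \<in> X" "y \<in> X" "\<And>n. s n \<in> X"
    and "(\<lambda>n. f (s n - x)) \<longlonglongrightarrow> 0" "(\<lambda>n. f (s n - y)) \<longlonglongrightarrow> 0"
  shows "x = y"
proof -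
  have "(\<lambda>n. f (s n - x) + f (s n - y)) \<longlonglongrightarrow> 0"
    using tendsto_add[OF assms(4,5)] by simp
  moreover have "f (x - y) \<le> f (s n - x) + f (s n - y)" for n
    using f_triangle[of x "s n" y] assms f_commute[of x "s n"] by simp
  ultimately have "f (x - y) \<le> 0"
    by (intro LIMSEQ_le_const) auto
  then have "f (x - y) = 0" using f_nonneg[of "x - y"] by simp
  then show ?thesis using f_eq_0[of "x - y"] assms by simp
qed

lemma f_tendsto_norm:
  assumes "x \<in> X" "\<And>n. s n \<in> X" "(\<lambda>n. f (s n - x)) \<longlonglongrightarrow> 0"
  shows "(\<lambda>n. f (s n)) \<longlonglongrightarrow> f x"
proof -
  have "\<bar>f (s n) - f x\<bar> \<le> f (s n - x)" for n
    using f_le_diff[of "s n" x] f_le_diff[of x "s n"] assms f_commute[of x "s n"] by auto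
  then have "(\<lambda>n. f (s n) - f x) \<longlonglongrightarrow> 0"
    by (intro Lim_null_comparison[OF _ assms(3)]) auto
  then show ?thesis by (simp add: LIM_zero_iff)
qed

lemma geometric_series:
  assumes a: "\<And>i. a i \<in> X" "\<And>i. f (a i) \<le> K * (1/2) ^ i"
  obtains x where "x \<in> X" "\<And>n. f ((\<Sum>i<n. a i) - x) \<le> 2 * K * (1/2) ^ n"
proof -
  have gs: "(\<Sum>i=n..<n+d. K * (1/2::real) ^ i) = 2 * K * (1/2) ^ n * (1 - (1/2)^d)" for n d :: nat
    by (induction d) (auto simp: algebra_simps power_add)
  have K: "0 \<le> K" using a(2)[of 0] f_nonneg[of "a 0"] by simp
  define s where "s n = (\<Sum>i<n. a i)" for n
  have s: "s n \<in> X" for n unfolding s_def using a by auto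
  have s_le: "f (s m - s n) \<le> 2 * K * (1/2) ^ n" if nm: "n \<le> m" for m n
  proof -
    obtain d where d: "m = n + d" using le_Suc_ex[OF nm] by blast
    have "s m - s n = (\<Sum>i=n..<m. a i)"
      unfolding s_def lessThan_atLeast0 using nm by (subst sum_diff_nat_ivl) auto
    then have "f (s m - s n) \<le> (\<Sum>i=n..<m. f (a i))" using a f_sum by metis
    also have "\<dots> \<le> (\<Sum>i=n..<m. K * (1/2) ^ i)" by (intro sum_mono a)
    also have "\<dots> \<le> 2 * K * (1/2) ^ n"
      unfolding d gs using K by (intro mult_left_le) auto
    finally show ?thesis .
  qed
  have lim: "(\<lambda>n. 2 * K * (1/2::real) ^ n) \<longlonglongrightarrow> 0"
    by (intro tendsto_mult_right_zero LIMSEQ_realpow_zero) auto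
  have "\<exists>x\<in>X. (\<lambda>n. f (s n - x)) \<longlonglongrightarrow> 0"
  proof (rule f_complete[OF s])
    fix \<epsilon> :: real assume "0 < \<epsilon>"
    then obtain N where N: "\<And>n. n \<ge> N \<Longrightarrow> 2 * K * (1/2::real) ^ n < \<epsilon>"
      using order_tendstoD(2)[OF lim, of \<epsilon>] by (auto simp: eventually_sequentially)
    have "f (s m - s n) < \<epsilon>" if "m \<ge> N" "n \<ge> N" for m n
      using s_le[of n m] s_le[of m n] N[OF that(1)] N[OF that(2)] f_commute[of "s m" "s n"]
      by (cases "n \<le> m") auto
    then show "\<exists>N. \<forall>m\<ge>N. \<forall>n\<ge>N. f (s m - s n) < \<epsilon>" by blast
  qed
  then obtain x where x: "x \<in> X" "(\<lambda>n. f (s n - x)) \<longlonglongrightarrow> 0" by blast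
  have "f (s n - x) \<le> 2 * K * (1/2) ^ n" for n
  proof (rule LIMSEQ_le_const2)
    have eq: "s n - s m - (s n - x) = x - s m" for m by simp
    show "(\<lambda>m. f (s n - s m)) \<longlonglongrightarrow> f (s n - x)"
    proof (rule f_tendsto_norm)
      show "(\<lambda>m. f (s n - s m - (s n - x))) \<longlonglongrightarrow> 0"
        unfolding eq f_commute[of x] by (rule x(2))
    qed (use s x in auto)
    show "\<exists>N. \<forall>m\<ge>N. f (s n - s m) \<le> 2 * K * (1/2) ^ n"
      using s_le[of n] by (auto simp: f_commute[of "s n"])
  qed
  then show ?thesis using that x(1) unfolding s_def by blast
qed

text \<open>The next two lemmas say that \<open>c \<mapsto> c v\<close> is a homeomorphism onto a closed line when \<open>v \<noteq> 0\<close>.\<close>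

lemma scalar_small:
  assumes v: "v \<in> X" "v \<noteq> 0" and "0 < \<eta>"
  shows "\<exists>\<epsilon>>0. \<forall>c. f (smul c v) < \<epsilon> \<longrightarrow> norm c < \<eta>"
proof -
  have "0 < f v" using f_eq_0[of v] f_nonneg[of v] v by linarith
  from scale_bounded[OF this, of "1/\<eta>"] obtain \<delta> where \<delta>: "0 < \<delta>"
    and *: "\<And>c x. x \<in> X \<Longrightarrow> norm c \<le> 1/\<eta> \<Longrightarrow> f x < \<delta> \<Longrightarrow> f (smul c x) < f v" by metis
  have "norm c < \<eta>" if "f (smul c v) < \<delta>" for c
  proof (rule ccontr)
    assume "\<not> norm c < \<eta>"
    then have c: "\<eta> \<le> norm c" "c \<noteq> 0" using \<open>0 < \<eta>\<close> by auto
    then have "norm (inverse c) \<le> 1/\<eta>"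
      using le_imp_inverse_le[OF c(1) \<open>0 < \<eta>\<close>] by (simp add: norm_inverse inverse_eq_divide norm_divide)
    from *[OF _ this that] v c show False by simp
  qed
  with \<delta> show ?thesis by blast
qed

lemma line_closed:
  assumes v: "v \<in> X" and y: "y \<in> X" and lim: "(\<lambda>k. f (smul (c k) v - y)) \<longlonglongrightarrow> 0"
  shows "\<exists>\<gamma>. y = smul \<gamma> v"
proof (cases "v = 0")
  case True
  then have "f (- y) = 0" using lim LIMSEQ_const_iff[of "f (- y)" 0] by simp
  then show ?thesis using f_eq_0[of "-y"] y True by auto
next
  case False
  have "Cauchy c"
  proof (rule metric_CauchyI)
    fix \<eta> :: real assume "0 < \<eta>"
    then obtain \<epsilon> where \<epsilon>: "0 < \<epsilon>" "\<And>c. f (smul c v) < \<epsilon> \<Longrightarrow> norm c < \<eta>"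
      using scalar_small[OF v False] by metis
    obtain N where N: "\<And>k. k \<ge> N \<Longrightarrow> f (smul (c k) v - y) < \<epsilon> / 2"
      using order_tendstoD(2)[OF lim, of "\<epsilon>/2"] \<epsilon> by (auto simp: eventually_sequentially)
    have "dist (c m) (c n) < \<eta>" if "m \<ge> N" "n \<ge> N" for m n
    proof -
      have "f (smul (c m) v - smul (c n) v) \<le> f (smul (c m) v - y) + f (y - smul (c n) v)"
        using v y by (intro f_triangle) auto
      then have "f (smul (c m - c n) v) < \<epsilon>"
        using N[OF that(1)] N[OF that(2)] f_commute[of y "smul (c n) v"]
        by (simp add: scale_left_diff_distrib)
      then show ?thesis using \<epsilon> by (simp add: dist_norm)
    qed
    then show "\<exists>M. \<forall>m\<ge>M. \<forall>n\<ge>M. dist (c m) (c n) < \<eta>" by blast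
  qed
  then obtain \<gamma> where \<gamma>: "c \<longlonglongrightarrow> \<gamma>" using Cauchy_convergent convergent_def by blast
  have "(\<lambda>k. f (smul (c k) v - smul \<gamma> v)) \<longlonglongrightarrow> 0"
  proof (rule f_tendsto_0I)
    fix a :: real assume "0 < a"
    then obtain r where r: "0 < r" "\<And>c. norm c < r \<Longrightarrow> f (smul c v) < a"
      using f_scale_vec[OF v] by metis
    then show "\<forall>\<^sub>F k in sequentially. f (smul (c k) v - smul \<gamma> v) < a"
      using tendstoD[OF \<gamma> r(1)]
      by (auto elim!: eventually_mono simp: scale_left_diff_distrib[symmetric] dist_norm)
  qed
  from f_limit_unique[OF _ y _ this lim] v show ?thesis by blast
qed

lemma eventually_scale_inverse:
  assumes "x \<in> X" "0 < \<epsilon>"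
  shows "\<forall>\<^sub>F k in sequentially. f (smul (inverse (of_nat (Suc k))) x) < \<epsilon>"
proof -
  obtain r where r: "0 < r" "\<And>c. norm c < r \<Longrightarrow> f (smul c x) < \<epsilon>"
    using f_scale_vec[OF assms] by metis
  have "\<forall>\<^sub>F k in sequentially. inverse (real (Suc k)) < r"
    using order_tendstoD(2)[OF LIMSEQ_inverse_real_of_nat r(1)] .
  then show ?thesis
    by eventually_elim (use r in \<open>auto simp: norm_inverse simp del: of_nat_Suc\<close>)
qed

sublocale M: Metric_space X "\<lambda>x y. f (x - y)"
proof
  show "0 \<le> f (x - y)" for x y by (rule f_nonneg)
  show "f (x - y) = f (y - x)" for x y by (rule f_commute)
  show "f (x - y) = 0 \<longleftrightarrow> x = y" if "x \<in> X" "y \<in> X" for x y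
    using that f_eq_0[of "x - y"] by simp
qed (rule f_triangle)

lemma limitin_iff:
  "limitin M.mtopology s x G \<longleftrightarrow> x \<in> X \<and> (\<forall>\<^sub>F n in G. s n \<in> X) \<and> ((\<lambda>n. f (s n - x)) \<longlongrightarrow> 0) G"
proof -
  have "((\<lambda>n. f (s n - x)) \<longlongrightarrow> 0) G \<longleftrightarrow> (\<forall>\<epsilon>>0. \<forall>\<^sub>F n in G. f (s n - x) < \<epsilon>)"
    unfolding tendsto_iff by (simp add: f_nonneg)
  then show ?thesis
    unfolding M.limitin_metric by (auto simp: eventually_conj_iff intro: zero_less_one)
qed

lemma mcomplete: "M.mcomplete"
  unfolding M.mcomplete_def
proof (intro allI impI)
  fix s assume s: "M.MCauchy s"
  then have 1: "s n \<in> X" for n unfolding M.MCauchy_def by auto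
  have "\<exists>x\<in>X. (\<lambda>n. f (s n - x)) \<longlonglongrightarrow> 0"
    using s 1 unfolding M.MCauchy_def by (intro f_complete) auto
  then show "\<exists>x. limitin M.mtopology s x sequentially"
    using 1 unfolding limitin_iff by auto
qed

end


section \<open>Continuity of the coordinate functionals\<close>

text \<open>A complete F-norm together with a Schauder basis \<open>e\<close> of \<open>X\<close>.\<close>

locale f_basis = f_space smul X f
  for smul :: "'k::{real_normed_field, euclidean_space} \<Rightarrow> 'a::ab_group_add \<Rightarrow> 'a" and X f +
  fixes e :: "nat \<Rightarrow> 'a"
  assumes e_mem [simp, intro]: "e j \<in> X"
    and basis: "x \<in> X \<Longrightarrow> \<exists>!c. (\<lambda>n. f ((\<Sum>j<n. smul (c j) (e j)) - x)) \<longlonglongrightarrow> 0"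
begin

abbreviation psum :: "(nat \<Rightarrow> 'k) \<Rightarrow> nat \<Rightarrow> 'a" where
  "psum c n \<equiv> \<Sum>j<n. smul (c j) (e j)"

text \<open>The coefficient sequence of \<open>x\<close>; it is meaningful for \<open>x \<in> X\<close> only.\<close>

definition coef :: "'a \<Rightarrow> nat \<Rightarrow> 'k" where
  "coef x = (THE c. (\<lambda>n. f (psum c n - x)) \<longlonglongrightarrow> 0)"

lemma psum_mem [simp, intro]: "psum c n \<in> X"
  by auto

lemma coef_lim: "x \<in> X \<Longrightarrow> (\<lambda>n. f (psum (coef x) n - x)) \<longlonglongrightarrow> 0"
  unfolding coef_def by (rule theI'[OF basis])

lemma coef_eqI: "x \<in> X \<Longrightarrow> (\<lambda>n. f (psum c n - x)) \<longlonglongrightarrow> 0 \<Longrightarrow> coef x = c"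
  unfolding coef_def by (rule the1_equality[OF basis])

lemma coef_diff:
  assumes x: "x \<in> X" and y: "y \<in> X"
  shows "coef (x - y) = (\<lambda>j. coef x j - coef y j)"
proof (rule coef_eqI)
  have eq: "psum (\<lambda>j. coef x j - coef y j) n - (x - y) = (psum (coef x) n - x) - (psum (coef y) n - y)" for n
    by (simp add: scale_left_diff_distrib sum_subtractf algebra_simps)
  have le: "f (psum (\<lambda>j. coef x j - coef y j) n - (x - y))
      \<le> f (psum (coef x) n - x) + f (psum (coef y) n - y)" for n
    unfolding eq by (rule f_diff) (use x y in auto)
  show "(\<lambda>n. f (psum (\<lambda>j. coef x j - coef y j) n - (x - y))) \<longlonglongrightarrow> 0"
    by (rule Lim_null_comparison[OF _ tendsto_add_zero[OF coef_lim[OF x] coef_lim[OF y]]])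
      (use le f_nonneg in auto)
qed (use assms in auto)

lemma coef_scale:
  assumes x: "x \<in> X"
  shows "coef (smul a x) = (\<lambda>j. a * coef x j)"
proof (rule coef_eqI)
  have eq: "psum (\<lambda>j. a * coef x j) n - smul a x = smul a (psum (coef x) n - x)" for n
    by (simp add: scale_right_diff_distrib scale_sum_right)
  show "(\<lambda>n. f (psum (\<lambda>j. a * coef x j) n - smul a x)) \<longlonglongrightarrow> 0"
    unfolding eq
  proof (rule f_tendsto_0I)
    fix b :: real assume "0 < b"
    from scale_bounded[OF this, of "norm a"] obtain \<delta> where \<delta>: "0 < \<delta>"
      and *: "\<And>c y. y \<in> X \<Longrightarrow> norm c \<le> norm a \<Longrightarrow> f y < \<delta> \<Longrightarrow> f (smul c y) < b" by metis
    show "\<forall>\<^sub>F n in sequentially. f (smul a (psum (coef x) n - x)) < b"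
      using order_tendstoD(2)[OF coef_lim[OF x] \<delta>] by eventually_elim (use x * in auto)
  qed
qed (use assms in auto)

lemma coef_add:
  assumes "x \<in> X" "y \<in> X"
  shows "coef (x + y) = (\<lambda>j. coef x j + coef y j)"
  using coef_diff[of x "smul (-1) y"] coef_scale[of y "-1"] assms by simp

lemma coef_psum: "coef (psum c N) = (\<lambda>j. if j < N then c j else 0)"
proof (rule coef_eqI)
  have "psum (\<lambda>j. if j < N then c j else 0) n = psum c N" if "n \<ge> N" for n
    by (rule sum.mono_neutral_cong_right) (use that in auto)
  then have "\<forall>\<^sub>F n in sequentially. f (psum (\<lambda>j. if j < N then c j else 0) n - psum c N) = 0"
    by (intro eventually_sequentiallyI[of N]) simp
  then show "(\<lambda>n. f (psum (\<lambda>j. if j < N then c j else 0) n - psum c N)) \<longlonglongrightarrow> 0"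
    by (rule tendsto_eventually)
qed auto

lemma e_nonzero: "e j \<noteq> 0"
proof
  assume "e j = 0"
  then have eq: "psum (\<lambda>i. if i = j then 1 else 0) n = 0" for n
    by (intro sum.neutral) auto
  have "coef 0 = (\<lambda>i. if i = j then 1 else 0)" by (rule coef_eqI) (simp_all add: eq)
  moreover have "coef 0 = (\<lambda>i. 0)" by (rule coef_eqI) simp_all
  ultimately show False by (metis zero_neq_one)
qed

text \<open>
  The closed \<open>\<epsilon>\<close>-ball of the finer F-norm \<open>x \<mapsto> sup\<^sub>n f (S\<^sub>n x)\<close>, where \<open>S\<^sub>n x\<close> is the \<open>n\<close>-th
  partial sum of the expansion of \<open>x\<close>. The aim is to show that it is a neighbourhood of 0 for \<open>f\<close>.
\<close>

definition sball :: "real \<Rightarrow> 'a set" where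
  "sball \<epsilon> = {x \<in> X. \<forall>n. f (psum (coef x) n) \<le> \<epsilon>}"

lemma sball_mem: "x \<in> sball \<epsilon> \<Longrightarrow> x \<in> X"
  by (simp add: sball_def)

lemma sball_diff:
  assumes "x \<in> sball a" "y \<in> sball b" shows "x - y \<in> sball (a + b)"
proof -
  have mem: "x \<in> X" "y \<in> X" using assms sball_mem by auto
  have "f (psum (coef (x - y)) n) \<le> a + b" for n
  proof -
    have "psum (coef (x - y)) n = psum (coef x) n - psum (coef y) n"
      using mem by (simp add: coef_diff scale_left_diff_distrib sum_subtractf)
    then have "f (psum (coef (x - y)) n) \<le> f (psum (coef x) n) + f (psum (coef y) n)"
      using mem by (auto intro!: f_diff)
    moreover have "f (psum (coef x) n) \<le> a" "f (psum (coef y) n) \<le> b"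
      using assms by (auto simp: sball_def)
    ultimately show ?thesis by linarith
  qed
  then show ?thesis using mem by (simp add: sball_def)
qed

text \<open>
  Scalar multiples of a convergent sequence by \<open>1/(k+1)\<close> tend to 0 uniformly along the sequence,
  so these balls are absorbing.
\<close>

lemma sball_absorbing:
  assumes x: "x \<in> X" and "0 < \<epsilon>"
  shows "\<exists>k. smul (inverse (of_nat (Suc k))) x \<in> sball \<epsilon>"
proof -
  define q :: "nat \<Rightarrow> 'k" where "q k = inverse (of_nat (Suc k))" for k
  have q: "norm (q k) \<le> 1" for k
    unfolding q_def by (simp add: norm_inverse inverse_le_1_iff del: of_nat_Suc)
  have "0 < \<epsilon> / 2" using assms by simp
  from scale_bounded[OF this, of 1] obtain \<delta> where \<delta>: "0 < \<delta>"
    and *: "\<And>c y. y \<in> X \<Longrightarrow> norm c \<le> 1 \<Longrightarrow> f y < \<delta> \<Longrightarrow> f (smul c y) < \<epsilon> / 2" by metis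
  obtain N where N: "\<And>n. n \<ge> N \<Longrightarrow> f (psum (coef x) n - x) < \<delta>"
    using order_tendstoD(2)[OF coef_lim[OF x] \<delta>] by (auto simp: eventually_sequentially)
  have "\<forall>\<^sub>F k in sequentially. \<forall>n\<in>{..<N}. f (smul (q k) (psum (coef x) n)) < \<epsilon>"
    unfolding q_def using \<open>0 < \<epsilon>\<close>
    by (intro eventually_ball_finite ballI eventually_scale_inverse) auto
  moreover have "\<forall>\<^sub>F k in sequentially. f (smul (q k) x) < \<epsilon> / 2"
    unfolding q_def using x \<open>0 < \<epsilon> / 2\<close> by (rule eventually_scale_inverse)
  ultimately have "\<exists>k. (\<forall>n\<in>{..<N}. f (smul (q k) (psum (coef x) n)) < \<epsilon>)
      \<and> f (smul (q k) x) < \<epsilon> / 2"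
    by (intro eventually_happens'[OF sequentially_bot] eventually_conj)
  then obtain k where k: "\<And>n. n < N \<Longrightarrow> f (smul (q k) (psum (coef x) n)) < \<epsilon>"
    "f (smul (q k) x) < \<epsilon> / 2"
    by auto
  have "f (smul (q k) (psum (coef x) n)) \<le> \<epsilon>" for n
  proof (cases "n < N")
    case True then show ?thesis using k by (simp add: less_imp_le)
  next
    case False
    then have "f (smul (q k) (psum (coef x) n - x)) < \<epsilon> / 2"
      using N q x by (intro *) auto
    moreover have "f (smul (q k) (psum (coef x) n))
        \<le> f (smul (q k) x) + f (smul (q k) (psum (coef x) n) - smul (q k) x)"
      using x by (intro f_le_diff) auto
    ultimately show ?thesis using k by (simp add: scale_right_diff_distrib)
  qed
  moreover have "psum (coef (smul (q k) x)) n = smul (q k) (psum (coef x) n)" for n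
    using x by (simp add: coef_scale scale_sum_right)
  ultimately have "smul (q k) x \<in> sball \<epsilon>" using x by (simp add: sball_def)
  then show ?thesis unfolding q_def by blast
qed

text \<open>
  The Baire step: the closure of \<open>sball \<epsilon>\<close> is a neighbourhood of 0. Membership in the closure is
  spelled out by approximating points.
\<close>

lemma closure_sball_nbhd:
  assumes "0 < \<epsilon>"
  shows "\<exists>\<rho>>0. \<forall>z\<in>X. f z < \<rho> \<longrightarrow> (\<forall>\<eta>>0. \<exists>w\<in>sball \<epsilon>. f (z - w) < \<eta>)"
proof -
  \<comment> \<open>\<open>A k\<close> is the dilation of \<open>sball (\<epsilon>/2)\<close> by \<open>k + 1\<close>; differences of its points, scaled back,
    lie in \<open>sball \<epsilon>\<close>.\<close>
  define A where "A k = {x \<in> X. smul (inverse (of_nat (Suc k))) x \<in> sball (\<epsilon>/2)}" for k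
  have A: "A k \<subseteq> X" for k by (auto simp: A_def)
  have X: "X = (\<Union>k. A k)"
    using sball_absorbing[of _ "\<epsilon>/2"] assms unfolding A_def by auto
  have "\<exists>k. M.mtopology interior_of (M.mtopology closure_of A k) \<noteq> {}"
  proof (rule ccontr)
    assume "\<not> ?thesis"
    then have "M.mtopology interior_of \<Union>(range (\<lambda>k. M.mtopology closure_of A k)) = {}"
      by (intro M.metric_Baire_category_alt[OF mcomplete]) auto
    moreover have "\<Union>(range (\<lambda>k. M.mtopology closure_of A k)) = X"
    proof
      show "\<Union>(range (\<lambda>k. M.mtopology closure_of A k)) \<subseteq> X"
        using closure_of_subset_topspace[of M.mtopology] by auto
      show "X \<subseteq> \<Union>(range (\<lambda>k. M.mtopology closure_of A k))"
      proof
        fix x assume "x \<in> X"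
        then obtain k where "x \<in> A k" using X by blast
        then show "x \<in> \<Union>(range (\<lambda>k. M.mtopology closure_of A k))"
          using closure_of_subset[of "A k" M.mtopology] A by auto
      qed
    qed
    ultimately have "X = {}" using interior_of_topspace[of M.mtopology] by simp
    then show False using mem(1) by blast
  qed
  then obtain k x0 where "x0 \<in> M.mtopology interior_of (M.mtopology closure_of A k)" by blast
  then obtain \<rho> where x0: "x0 \<in> X" "0 < \<rho>" and ball: "M.mball x0 \<rho> \<subseteq> M.mtopology closure_of A k"
    unfolding M.metric_interior_of by auto
  have cl: "\<exists>u\<in>A k. f (y - u) < \<eta>" if "y \<in> X" "f (x0 - y) < \<rho>" "0 < \<eta>" for y \<eta>
  proof -
    have "y \<in> M.mtopology closure_of A k" using ball that x0 by auto
    then show ?thesis using that(3) unfolding M.metric_closure_of by fastforce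
  qed
  define K where "K = real (Suc k)"
  define q :: 'k where "q = inverse (of_nat (Suc k))"
  have q: "norm q \<le> 1" "q \<noteq> 0"
    unfolding q_def by (auto simp: norm_inverse inverse_le_1_iff simp del: of_nat_Suc)
  have "\<exists>w\<in>sball \<epsilon>. f (z - w) < \<eta>" if z: "z \<in> X" "f z < \<rho> / K" and "0 < \<eta>" for z \<eta>
  proof -
    define z' where "z' = smul (of_nat (Suc k)) z"
    have "f z' \<le> K * f z" unfolding z'_def K_def using z by (intro f_of_nat)
    also have "\<dots> < \<rho>" using z unfolding K_def by (simp add: field_simps)
    finally have z': "f z' < \<rho>" "z' \<in> X" using z by (auto simp: z'_def)
    have qz: "smul q z' = z" unfolding z'_def q_def by (simp del: of_nat_Suc)
    from scale_bounded[OF \<open>0 < \<eta>\<close>, of 1] obtain \<delta> where \<delta>: "0 < \<delta>"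
      and *: "\<And>c y. y \<in> X \<Longrightarrow> norm c \<le> 1 \<Longrightarrow> f y < \<delta> \<Longrightarrow> f (smul c y) < \<eta>" by metis
    obtain u where u: "u \<in> A k" "f (x0 + z' - u) < \<delta>/2"
      using cl[of "x0 + z'" "\<delta>/2"] z' \<delta> x0 by (auto simp: f_minus)
    obtain v where v: "v \<in> A k" "f (x0 - v) < \<delta>/2"
      using cl[of "x0" "\<delta>/2"] \<delta> x0 by auto
    have "f ((x0 + z' - u) - (x0 - v)) < \<delta>"
      using f_diff[of "x0 + z' - u" "x0 - v"] u v x0 z' A by (smt (verit) field_sum_of_halves mem subsetD)
    then have "f (z' - (u - v)) < \<delta>" by (simp add: algebra_simps)
    then have "f (smul q (z' - (u - v))) < \<eta>"
      using u v A z' q by (intro *) auto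
    then have "f (z - (smul q u - smul q v)) < \<eta>"
      by (simp add: scale_right_diff_distrib qz)
    moreover have "smul q u - smul q v \<in> sball (\<epsilon>/2 + \<epsilon>/2)"
      using u v unfolding A_def q_def by (intro sball_diff) auto
    ultimately show ?thesis by auto
  qed
  moreover have "0 < \<rho> / K" using x0 by (simp add: K_def)
  ultimately show ?thesis by blast
qed

text \<open>
  Completeness for the finer F-norm. The coordinatewise sums of the expansions of the \<open>w i\<close>
  converge uniformly in the index \<open>n\<close> of the partial sum; consecutive limits differ by a multiple of
  \<open>e n\<close> because lines are closed, so the limits are the partial sums of one series, and that series
  is the expansion of \<open>z\<close>.
\<close>

lemma sball_of_series:
  assumes w: "\<And>i. w i \<in> sball (\<epsilon> * (1/2) ^ i)" and z: "z \<in> X"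
    and lim: "(\<lambda>k. f ((\<Sum>i<k. w i) - z)) \<longlonglongrightarrow> 0"
  shows "z \<in> sball (2 * \<epsilon>)"
proof -
  have wX: "w i \<in> X" for i using w sball_mem by blast
  define s where "s n k = (\<Sum>i<k. psum (coef (w i)) n)" for n k
  have s_psum: "s n k = psum (\<lambda>j. \<Sum>i<k. coef (w i) j) n" for n k
    unfolding s_def by (subst sum.swap) (simp add: scale_sum_left)
  have s_coef: "s n k = psum (coef (\<Sum>i<k. w i)) n" for n k
  proof -
    have "coef (\<Sum>i<k. w i) = (\<lambda>j. \<Sum>i<k. coef (w i) j)"
    proof (induction k)
      case (Suc k)
      have "coef ((\<Sum>i<k. w i) + w k) = (\<lambda>j. coef (\<Sum>i<k. w i) j + coef (w k) j)"
        using wX by (intro coef_add) auto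
      then show ?case using Suc by simp
    qed (use coef_psum[of "\<lambda>_. 0" 0] in simp)
    then show ?thesis unfolding s_psum by simp
  qed
  have "\<exists>y\<in>X. \<forall>k. f (s n k - y) \<le> 2 * \<epsilon> * (1/2) ^ k" for n
  proof -
    have "f (psum (coef (w i)) n) \<le> \<epsilon> * (1/2) ^ i" for i using w by (auto simp: sball_def)
    from geometric_series[of "\<lambda>i. psum (coef (w i)) n", OF psum_mem this]
    show ?thesis unfolding s_def by blast
  qed
  then obtain y where y: "\<And>n. y n \<in> X" and y_le: "\<And>n k. f (s n k - y n) \<le> 2 * \<epsilon> * (1/2) ^ k"
    by metis
  have null: "(\<lambda>k. 2 * \<epsilon> * (1/2::real) ^ k) \<longlonglongrightarrow> 0"
    by (intro tendsto_mult_right_zero LIMSEQ_realpow_zero) auto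
  have s_lim: "(\<lambda>k. f (s n k - y n)) \<longlonglongrightarrow> 0" for n
    by (rule Lim_null_comparison[OF _ null]) (use y_le f_nonneg in auto)
  have sX: "s n k \<in> X" for n k unfolding s_psum by auto
  have "\<exists>\<gamma>. y (Suc n) - y n = smul \<gamma> (e n)" for n
  proof (rule line_closed)
    have eq: "smul (\<Sum>i<k. coef (w i) n) (e n) - (y (Suc n) - y n)
        = (s (Suc n) k - y (Suc n)) - (s n k - y n)" for k
      unfolding s_psum by (simp add: algebra_simps)
    have le: "f (smul (\<Sum>i<k. coef (w i) n) (e n) - (y (Suc n) - y n))
        \<le> f (s (Suc n) k - y (Suc n)) + f (s n k - y n)" for k
      unfolding eq by (rule f_diff) (use sX y in auto)
    show "(\<lambda>k. f (smul (\<Sum>i<k. coef (w i) n) (e n) - (y (Suc n) - y n))) \<longlonglongrightarrow> 0"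
      by (rule Lim_null_comparison[OF _ tendsto_add_zero[OF s_lim[of "Suc n"] s_lim[of n]]])
        (use le f_nonneg in auto)
  qed (use y in auto)
  then obtain \<gamma> where \<gamma>: "\<And>n. y (Suc n) - y n = smul (\<gamma> n) (e n)" by metis
  have "y 0 = 0"
    by (rule f_limit_unique[OF y _ sX s_lim]) (simp_all add: s_psum)
  then have y_psum: "y n = psum \<gamma> n" for n
  proof (induction n)
    case (Suc n)
    then show ?case using \<gamma>[of n] by (simp add: algebra_simps)
  qed simp
  have "(\<lambda>n. f (psum \<gamma> n - z)) \<longlonglongrightarrow> 0"
  proof (rule f_tendsto_0I)
    fix a :: real assume "0 < a"
    then have a: "0 < a / 3" by simp
    have "\<exists>k. 2 * \<epsilon> * (1/2) ^ k < a/3 \<and> f ((\<Sum>i<k. w i) - z) < a/3"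
      by (intro eventually_happens'[OF sequentially_bot] eventually_conj order_tendstoD(2)[OF null a] order_tendstoD(2)[OF lim a])
    then obtain k where k: "2 * \<epsilon> * (1/2) ^ k < a/3" "f ((\<Sum>i<k. w i) - z) < a/3"
      by blast
    define v where "v = (\<Sum>i<k. w i)"
    have v: "v \<in> X" unfolding v_def using wX by auto
    show "\<forall>\<^sub>F n in sequentially. f (psum \<gamma> n - z) < a"
      using order_tendstoD(2)[OF coef_lim[OF v] a]
    proof eventually_elim
      case (elim n)
      have "f (y n - z) \<le> f (y n - s n k) + f (s n k - z)"
        by (rule f_triangle) (use y sX z in auto)
      moreover have "f (s n k - z) \<le> f (s n k - v) + f (v - z)"
        by (rule f_triangle) (use y sX z v in auto)
      moreover have "f (y n - s n k) < a/3" using y_le[of n k] k f_commute[of "y n"] by simp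
      ultimately show ?case using k elim unfolding y_psum s_coef v_def by simp
    qed
  qed
  then have coef_z: "coef z = \<gamma>" using z by (intro coef_eqI)
  have "f (psum (coef z) n) \<le> 2 * \<epsilon>" for n
    using y_le[of n 0] unfolding coef_z y_psum[symmetric] by (simp add: s_psum f_minus)
  then show ?thesis using z by (simp add: sball_def)
qed

text \<open>The successive approximation of the open mapping theorem removes the closure.\<close>

lemma sball_nbhd:
  assumes "0 < \<epsilon>"
  shows "\<exists>\<rho>>0. \<forall>z\<in>X. f z < \<rho> \<longrightarrow> z \<in> sball \<epsilon>"
proof -
  have "\<exists>\<rho>>0. \<rho> \<le> (1/2)^i \<and> (\<forall>z\<in>X. f z < \<rho> \<longrightarrow> (\<forall>\<eta>>0. \<exists>w\<in>sball (\<epsilon>/2 * (1/2) ^ i). f (z - w) < \<eta>))"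
    for i :: nat
  proof -
    have "0 < \<epsilon>/2 * (1/2) ^ i" using assms by simp
    from closure_sball_nbhd[OF this] obtain \<rho> where "0 < \<rho>"
      "\<And>z \<eta>. z \<in> X \<Longrightarrow> f z < \<rho> \<Longrightarrow> 0 < \<eta> \<Longrightarrow> \<exists>w\<in>sball (\<epsilon>/2 * (1/2) ^ i). f (z - w) < \<eta>" by metis
    then show ?thesis by (intro exI[of _ "min \<rho> ((1/2)^i)"]) auto
  qed
  then obtain \<rho> where \<rho>: "\<And>i. 0 < \<rho> i" "\<And>i. \<rho> i \<le> (1/2)^i"
    and ex: "\<And>i z \<eta>. z \<in> X \<Longrightarrow> f z < \<rho> i \<Longrightarrow> 0 < \<eta> \<Longrightarrow> \<exists>w\<in>sball (\<epsilon>/2 * (1/2) ^ i). f (z - w) < \<eta>"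
    by metis
  have "z \<in> sball \<epsilon>" if z: "z \<in> X" "f z < \<rho> 0" for z
  proof -
    \<comment> \<open>\<open>r i\<close> is the remainder of \<open>z\<close> after \<open>i\<close> approximation steps.\<close>
    have "\<exists>r. \<forall>i. (r i \<in> X \<and> f (r i) < \<rho> i \<and> (i = 0 \<longrightarrow> r i = z)) \<and>
        r i - r (Suc i) \<in> sball (\<epsilon>/2 * (1/2) ^ i)"
    proof (rule dependent_nat_choice)
      fix r i assume r: "r \<in> X \<and> f r < \<rho> i \<and> (i = 0 \<longrightarrow> r = z)"
      then obtain w where "w \<in> sball (\<epsilon>/2 * (1/2) ^ i)" "f (r - w) < \<rho> (Suc i)"
        using ex \<rho>(1) by metis
      then show "\<exists>r'. (r' \<in> X \<and> f r' < \<rho> (Suc i) \<and> (Suc i = 0 \<longrightarrow> r' = z)) \<and>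
          r - r' \<in> sball (\<epsilon>/2 * (1/2) ^ i)"
        using r sball_mem by (intro exI[of _ "r - w"]) auto
    qed (use z in auto)
    then obtain r where r: "\<And>i. r i \<in> X" "\<And>i. f (r i) < \<rho> i" "r 0 = z"
      "\<And>i. r i - r (Suc i) \<in> sball (\<epsilon>/2 * (1/2) ^ i)" by metis
    have eq: "(\<Sum>i<k. r i - r (Suc i)) - z = - r k" for k
      using r(3) by (simp add: sum_lessThan_telescope')
    have "(\<lambda>k. (1/2::real) ^ k) \<longlonglongrightarrow> 0" by (rule LIMSEQ_realpow_zero) auto
    then have "(\<lambda>k. f ((\<Sum>i<k. r i - r (Suc i)) - z)) \<longlonglongrightarrow> 0"
      unfolding eq f_minus
      by (rule Lim_null_comparison[rotated])
        (use r(2) \<rho>(2) f_nonneg in \<open>auto intro!: always_eventually intro: less_imp_le less_le_trans\<close>)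
    from sball_of_series[OF r(4) z(1) this] show ?thesis by simp
  qed
  with \<rho>(1) show ?thesis by blast
qed

text \<open>Banach's theorem on the continuity of the coordinate functionals of a Schauder basis.\<close>

theorem coef_continuous:
  assumes "0 < \<eta>"
  shows "\<exists>\<rho>>0. \<forall>z\<in>X. f z < \<rho> \<longrightarrow> norm (coef z j) < \<eta>"
proof -
  obtain \<epsilon> where \<epsilon>: "0 < \<epsilon>" "\<And>c. f (smul c (e j)) < \<epsilon> \<Longrightarrow> norm c < \<eta>"
    using scalar_small[OF e_mem e_nonzero assms] by metis
  obtain \<rho> where \<rho>: "0 < \<rho>" "\<And>z. z \<in> X \<Longrightarrow> f z < \<rho> \<Longrightarrow> z \<in> sball (\<epsilon>/3)"
    using sball_nbhd[of "\<epsilon>/3"] \<epsilon> by auto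
  have "norm (coef z j) < \<eta>" if "z \<in> X" "f z < \<rho>" for z
  proof (rule \<epsilon>(2))
    have le: "f (psum (coef z) n) \<le> \<epsilon>/3" for n using \<rho>(2)[OF that] by (simp add: sball_def)
    have "f (psum (coef z) (Suc j) - psum (coef z) j) \<le> \<epsilon>/3 + \<epsilon>/3"
      by (rule order_trans[OF f_diff add_mono[OF le le]]) auto
    then show "f (smul (coef z j) (e j)) < \<epsilon>" using \<epsilon>(1) by simp
  qed
  with \<rho>(1) show ?thesis by blast
qed

end


section \<open>Coordinates on an LF-space\<close>

lemma frechet_f_space:
  fixes smul :: "'k::{real_normed_field, euclidean_space} \<Rightarrow> 'a::ab_group_add \<Rightarrow> 'a"
  assumes vs: "vector_space smul" and fr: "frechet_space smul T"
  obtains f where "f_space smul (topspace T) f"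
    "T = Metric_space.mtopology (topspace T) (\<lambda>x y. f (x - y))"
proof -
  interpret vector_space smul by (rule vs)
  define X where "X = topspace T"
  obtain d where d: "mspace d = X" "mtopology_of d = T" "mcomplete_of d"
    and inv: "\<And>x y z. x \<in> X \<Longrightarrow> y \<in> X \<Longrightarrow> z \<in> X \<Longrightarrow> mdist d (x + z) (y + z) = mdist d x y"
    using fr unfolding frechet_space_def X_def by metis
  have tvs: "topological_vector_space smul T"
    using fr unfolding frechet_space_def locally_convex_space_def by blast
  have sub: "subspace X" using tvs unfolding topological_vector_space_def X_def by blast
  have mem: "0 \<in> X" "x \<in> X \<Longrightarrow> y \<in> X \<Longrightarrow> x + y \<in> X" "x \<in> X \<Longrightarrow> y \<in> X \<Longrightarrow> x - y \<in> X"
    "x \<in> X \<Longrightarrow> smul c x \<in> X" "x \<in> X \<Longrightarrow> - x \<in> X" for x y c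
    using sub by (auto intro: subspace_0 subspace_add subspace_diff subspace_scale subspace_neg)
  \<comment> \<open>The value 1 off \<open>X\<close> is arbitrary; a constant keeps \<open>f\<close> nonnegative and even on the type.\<close>
  define f where "f x = (if x \<in> X then mdist d x 0 else 1)" for x
  have f_dist: "f (x - y) = mdist d x y" if "x \<in> X" "y \<in> X" for x y
    using inv[of "x - y" 0 y] that mem by (simp add: f_def)
  interpret D: Metric_space X "mdist d"
    using Metric_space_mspace_mdist[of d] unfolding d(1) .
  have T: "T = D.mtopology" using d(2) unfolding mtopology_of_def d(1) by simp
  have ms: "Metric_space X (\<lambda>x y. f (x - y))"
  proof
    fix x y z
    show "0 \<le> f (x - y)" by (simp add: f_def)
    have "x - y \<in> X \<longleftrightarrow> y - x \<in> X" using mem(5)[of "x - y"] mem(5)[of "y - x"] by auto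
    moreover have "f (x - y) = f (y - x)" if "x - y \<in> X"
      using f_dist[of "x - y" 0] f_dist[of 0 "x - y"] that mem(1) mdist_commute[of d] by simp
    ultimately show "f (x - y) = f (y - x)" by (auto simp: f_def)
  next
    fix x y assume "x \<in> X" "y \<in> X"
    then show "f (x - y) = 0 \<longleftrightarrow> x = y" by (simp add: f_dist)
  next
    fix x y z assume "x \<in> X" "y \<in> X" "z \<in> X"
    then show "f (x - z) \<le> f (x - y) + f (y - z)" by (simp add: f_dist D.triangle)
  qed
  interpret M: Metric_space X "\<lambda>x y. f (x - y)" by (rule ms)
  have ball: "M.mball x r = D.mball x r" for x r
    by (auto simp: f_dist)
  have TM: "T = M.mtopology"
    unfolding T topology_eq D.openin_mtopology M.openin_mtopology ball by simp
  have scale_cont: "continuous_map (prod_topology euclidean T) T (\<lambda>(c, x). smul c x)"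
    using tvs unfolding topological_vector_space_def by blast
  have scale: "\<exists>r>0. \<exists>\<delta>>0. \<forall>c. \<forall>y\<in>X. norm c < r \<longrightarrow> f (y - x) < \<delta> \<longrightarrow> f (smul c y) < \<epsilon>"
    if x: "x \<in> X" and \<epsilon>: "0 < \<epsilon>" for x \<epsilon>
  proof -
    have "openin (prod_topology euclidean T)
        {p \<in> topspace (prod_topology euclidean T). (\<lambda>(c, x). smul c x) p \<in> M.mball 0 \<epsilon>}"
      using scale_cont M.openin_mball[of 0 \<epsilon>] unfolding TM[symmetric] by (rule openin_continuous_map_preimage)
    moreover have "(0, x) \<in> {p \<in> topspace (prod_topology euclidean T). (\<lambda>(c, x). smul c x) p \<in> M.mball 0 \<epsilon>}"
      using x \<epsilon> mem(1) M.zero[of 0 0] by (simp add: X_def[symmetric])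
    ultimately obtain U V where UV: "openin euclidean U" "openin T V" "0 \<in> U" "x \<in> V"
      and sub: "U \<times> V \<subseteq> {p \<in> topspace (prod_topology euclidean T). (\<lambda>(c, x). smul c x) p \<in> M.mball 0 \<epsilon>}"
      unfolding openin_prod_topology_alt by meson
    obtain r where r: "0 < r" "ball 0 r \<subseteq> U" using UV by (auto simp: open_contains_ball)
    obtain \<delta> where \<delta>: "0 < \<delta>" "M.mball x \<delta> \<subseteq> V"
      using UV unfolding TM M.openin_mtopology by blast
    have "f (smul c y) < \<epsilon>" if "y \<in> X" "norm c < r" "f (y - x) < \<delta>" for c y
    proof -
      have "(c, y) \<in> U \<times> V" using that r \<delta> x M.commute[of x y] by auto
      then have "smul c y \<in> M.mball 0 \<epsilon>" using sub by auto
      then show ?thesis using M.commute[of 0 "smul c y"] by simp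
    qed
    with r(1) \<delta>(1) show ?thesis by blast
  qed
  have "f_space smul X f"
  proof unfold_locales
    show "subspace X" by (rule sub)
    show "0 \<le> f x" for x by (simp add: f_def)
    show "f (- x) = f x" for x using M.commute[of 0 x] by simp
    show "f x = 0 \<longleftrightarrow> x = 0" if "x \<in> X" for x using M.zero[OF that mem(1)] by simp
    show "f (x + y) \<le> f x + f y" if "x \<in> X" "y \<in> X" for x y
      using M.triangle[of x 0 "- y"] M.commute[of 0 "- y"] M.commute[of 0 y] that mem by simp
  next
    fix x and \<epsilon> :: real assume x: "x \<in> X" "0 < \<epsilon>"
    then show "\<exists>r>0. \<forall>c. norm c < r \<longrightarrow> f (smul c x) < \<epsilon>"
      using scale[OF x] M.zero[OF x(1) x(1)] by metis
  next
    fix \<epsilon> :: real assume "0 < \<epsilon>"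
    then show "\<exists>r>0. \<exists>\<delta>>0. \<forall>c. \<forall>x\<in>X. norm c < r \<longrightarrow> f x < \<delta> \<longrightarrow> f (smul c x) < \<epsilon>"
      using scale[OF mem(1)] by simp
  next
    fix s :: "nat \<Rightarrow> 'a"
    assume s: "\<And>n. s n \<in> X" "\<And>\<epsilon>. 0 < \<epsilon> \<Longrightarrow> \<exists>N. \<forall>m\<ge>N. \<forall>n\<ge>N. f (s m - s n) < \<epsilon>"
    have "D.mcomplete" using d(3) unfolding mcomplete_of_def d(1) .
    moreover have "D.MCauchy s"
      using s(2) s(1) unfolding D.MCauchy_def by (auto simp: f_dist)
    ultimately obtain x where "limitin D.mtopology s x sequentially"
      unfolding D.mcomplete_def by blast
    then have "x \<in> X" "\<And>\<epsilon>. 0 < \<epsilon> \<Longrightarrow> \<forall>\<^sub>F n in sequentially. f (s n - x) < \<epsilon>"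
      unfolding D.limitin_metric by (auto simp: f_dist s(1))
    then have "(\<lambda>n. f (s n - x)) \<longlonglongrightarrow> 0"
      unfolding tendsto_iff by (simp add: f_def)
    with \<open>x \<in> X\<close> show "\<exists>x\<in>X. (\<lambda>n. f (s n - x)) \<longlonglongrightarrow> 0" by blast
  qed
  with TM show ?thesis using that unfolding X_def by blast
qed

text \<open>
  An LF-space with stepwise Schauder basis \<open>e\<close>, where the topology of the step \<open>F m\<close> is
  given by a fixed complete F-norm \<open>N m\<close>.
\<close>

locale lf_basis = vector_space smul
  for smul :: "'k::{real_normed_field, euclidean_space} \<Rightarrow> 'a::ab_group_add \<Rightarrow> 'a" +
  fixes F :: "nat \<Rightarrow> 'a topology" and T :: "'a topology" and e :: "nat \<Rightarrow> 'a"
    and N :: "nat \<Rightarrow> 'a \<Rightarrow> real"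
  assumes lf: "lf_space smul F T"
    and step_basis: "f_basis smul (topspace (F m)) (N m) e"
    and step_topology: "F m = Metric_space.mtopology (topspace (F m)) (\<lambda>x y. N m (x - y))"
begin

sublocale step: f_basis smul "topspace (F m)" "N m" e for m
  by (rule step_basis)

abbreviation psum :: "(nat \<Rightarrow> 'k) \<Rightarrow> nat \<Rightarrow> 'a" where
  "psum c n \<equiv> \<Sum>j<n. smul (c j) (e j)"

lemma step_limit: "limitin (F m) s x G \<longleftrightarrow>
    x \<in> topspace (F m) \<and> (\<forall>\<^sub>F n in G. s n \<in> topspace (F m)) \<and> ((\<lambda>n. N m (s n - x)) \<longlongrightarrow> 0) G"
  using step.limitin_iff[of m s x G] unfolding step_topology[symmetric] .

lemma step_openin: "openin (F m) U \<longleftrightarrow>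
    U \<subseteq> topspace (F m) \<and> (\<forall>x. x \<in> U \<longrightarrow> (\<exists>r>0. step.M.mball m x r \<subseteq> U))"
  using step.M.openin_mtopology[of m U] unfolding step_topology[symmetric] .

lemma step_limit_seq: "(\<And>n. s n \<in> topspace (F m)) \<Longrightarrow> limitin (F m) s x sequentially \<longleftrightarrow>
    x \<in> topspace (F m) \<and> (\<lambda>n. N m (s n - x)) \<longlonglongrightarrow> 0"
  by (simp add: step_limit)

lemma topspace_T: "topspace T = (\<Union>m. topspace (F m))"
  using lf unfolding lf_space_def inductive_limit_def admissible_topology_def by blast

lemma step_continuous_T: "continuous_map (F m) T (\<lambda>x. x)"
  using lf unfolding lf_space_def inductive_limit_def admissible_topology_def by blast

lemma limit_T: "limitin (F m) s x G \<Longrightarrow> limitin T s x G"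
  using continuous_map_limit[OF step_continuous_T] by (simp add: comp_def)

lemma Hausdorff_T: "Hausdorff_space T"
  using lf unfolding lf_space_def by blast

lemma finest: "admissible_topology smul F T' \<Longrightarrow> openin T' U \<Longrightarrow> openin T U"
  using lf unfolding lf_space_def inductive_limit_def by blast

lemma subspace_T: "subspace (topspace T)"
  using lf unfolding lf_space_def inductive_limit_def admissible_topology_def
    locally_convex_space_def topological_vector_space_def by blast

lemma step_continuous_mono:
  assumes "m \<le> k" shows "continuous_map (F m) (F k) (\<lambda>x. x)"
  using assms
proof (induction k rule: dec_induct)
  case (step k)
  have "continuous_map (F k) (F (Suc k)) (\<lambda>x. x)"
    using lf unfolding lf_space_def inductive_spectrum_def by blast
  from continuous_map_compose[OF step.IH this] show ?case by (simp add: comp_def)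
qed simp

lemma step_mono: "m \<le> k \<Longrightarrow> topspace (F m) \<subseteq> topspace (F k)"
  using step_continuous_mono[of m k] unfolding continuous_map_def by auto

lemma limit_mono: "m \<le> k \<Longrightarrow> limitin (F m) s x G \<Longrightarrow> limitin (F k) s x G"
  using continuous_map_limit[OF step_continuous_mono] by (force simp: comp_def)

text \<open>
  The coefficients of a vector of the LF-space. They are the same in all steps that contain the
  vector. The expansion is taken in the steps, since its uniqueness in the inductive limit topology
  is not assumed.
\<close>

definition coord :: "'a \<Rightarrow> nat \<Rightarrow> 'k" where
  "coord y = (THE c. \<exists>m. limitin (F m) (psum c) y sequentially)"

lemma coord_eqI:
  assumes "limitin (F m) (psum c) y sequentially"
  shows "coord y = c"
  unfolding coord_def
proof (rule the_equality)
  fix c' assume "\<exists>m. limitin (F m) (psum c') y sequentially"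
  then obtain m' where m': "limitin (F m') (psum c') y sequentially" by blast
  define k where "k = max m m'"
  have "limitin (F k) (psum c') y sequentially" "limitin (F k) (psum c) y sequentially"
    using assms m' limit_mono[of m k] limit_mono[of m' k] unfolding k_def by auto
  then show "c' = c"
    using step.coef_eqI[of y k c] step.coef_eqI[of y k c'] by (simp add: step_limit)
qed (use assms in blast)

lemma coord_step: "y \<in> topspace (F m) \<Longrightarrow> coord y = step.coef m y"
  by (rule coord_eqI[of m]) (simp add: step_limit_seq step.coef_lim)

lemma coord_limit: "y \<in> topspace (F m) \<Longrightarrow> limitin (F m) (psum (coord y)) y sequentially"
  by (simp add: coord_step step_limit_seq step.coef_lim)

lemma coord_psum: "coord (psum c n) = (\<lambda>j. if j < n then c j else 0)"
  using coord_step[of "psum c n" 0] by (simp add: step.coef_psum)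

lemma common_step:
  assumes "x \<in> topspace T" "y \<in> topspace T"
  obtains m where "x \<in> topspace (F m)" "y \<in> topspace (F m)"
proof -
  obtain a b where "x \<in> topspace (F a)" "y \<in> topspace (F b)" using assms topspace_T by auto
  then show ?thesis using that[of "max a b"] step_mono[of a "max a b"] step_mono[of b "max a b"] by auto
qed

lemma coord_add:
  assumes "x \<in> topspace T" "y \<in> topspace T"
  shows "coord (x + y) j = coord x j + coord y j"
proof -
  obtain m where m: "x \<in> topspace (F m)" "y \<in> topspace (F m)"
    using common_step[OF assms] .
  then show ?thesis using coord_step[of _ m] by (simp add: step.coef_add)
qed

lemma coord_scale:
  assumes "x \<in> topspace T"
  shows "coord (smul a x) j = a * coord x j"
proof -
  obtain m where m: "x \<in> topspace (F m)" using assms topspace_T by auto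
  then show ?thesis using coord_step[of _ m] by (simp add: step.coef_scale)
qed

lemma coord_continuous_step: "continuous_map (F m) euclidean (\<lambda>y. coord y j)"
  unfolding continuous_map_def
proof (intro conjI allI impI)
  fix U :: "'k set" assume "openin euclidean U"
  then have U: "open U" by simp
  show "openin (F m) {x \<in> topspace (F m). coord x j \<in> U}"
    unfolding step_openin
  proof (intro conjI allI impI)
    fix x assume "x \<in> {x \<in> topspace (F m). coord x j \<in> U}"
    then have x: "x \<in> topspace (F m)" "coord x j \<in> U" by auto
    obtain \<eta> where \<eta>: "0 < \<eta>" "ball (coord x j) \<eta> \<subseteq> U" using U x open_contains_ball by metis
    obtain \<rho> where \<rho>: "0 < \<rho>" "\<And>z. z \<in> topspace (F m) \<Longrightarrow> N m z < \<rho> \<Longrightarrow> norm (step.coef m z j) < \<eta>"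
      using step.coef_continuous[OF \<eta>(1)] by metis
    have "coord y j \<in> U" if y: "y \<in> topspace (F m)" "N m (x - y) < \<rho>" for y
    proof -
      have "norm (step.coef m (x - y) j) < \<eta>" using \<rho> x y by blast
      then have "coord y j \<in> ball (coord x j) \<eta>"
        using x y by (simp add: step.coef_diff coord_step[of _ m] dist_norm)
      then show ?thesis using \<eta> by blast
    qed
    then show "\<exists>r>0. step.M.mball m x r \<subseteq> {x \<in> topspace (F m). coord x j \<in> U}"
      using \<rho>(1) by (intro exI[of _ \<rho>]) auto
  qed auto
qed simp

text \<open>
  The coordinates are linear and continuous on every step. Hence the initial topology of a coordinate
  is one of the competing locally convex topologies, and the inductive limit topology is finer.
\<close>

lemma coord_continuous: "continuous_map T euclidean (\<lambda>y. coord y j)"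
proof -
  define g where "g y = coord y j" for y
  define T' where "T' = pullback_topology (topspace T) g euclidean"
  have top: "topspace T' = topspace T" unfolding T'_def topspace_pullback_topology by simp
  have g: "continuous_map T' euclidean g"
    using continuous_map_pullback[of euclidean euclidean id "topspace T" g] by (simp add: T'_def id_comp)
  have into_T': "continuous_map Y T' h"
    if "continuous_map Y euclidean (\<lambda>y. g (h y))" "\<And>y. y \<in> topspace Y \<Longrightarrow> h y \<in> topspace T"
    for Y :: "'b topology" and h
    unfolding T'_def using that by (intro continuous_map_pullback') (auto simp: comp_def)
  have add: "continuous_map (prod_topology T' T') T' (\<lambda>(x, y). x + y)"
  proof (rule into_T')
    have c: "continuous_map (prod_topology T' T') euclidean (\<lambda>p. g (fst p) + g (snd p))"
      using continuous_map_compose[OF continuous_map_fst g] continuous_map_compose[OF continuous_map_snd g]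
      by (intro continuous_map_add) (auto simp: comp_def)
    show "continuous_map (prod_topology T' T') euclidean (\<lambda>p. g (case p of (x, y) \<Rightarrow> x + y))"
      by (rule continuous_map_eq[OF c]) (auto simp: top g_def coord_add)
    show "(case p of (x, y) \<Rightarrow> x + y) \<in> topspace T" if "p \<in> topspace (prod_topology T' T')" for p
      using that subspace_T by (auto simp: top subspace_add)
  qed
  have scale: "continuous_map (prod_topology euclidean T') T' (\<lambda>(c, x). smul c x)"
  proof (rule into_T')
    have c: "continuous_map (prod_topology euclidean T') euclidean (\<lambda>p. fst p * g (snd p))"
      using continuous_map_compose[OF continuous_map_snd g, of euclidean]
        continuous_map_fst[of "euclidean :: 'k topology" T']
      by (fastforce simp: comp_def continuous_map_atin intro: tendsto_mult)
    show "continuous_map (prod_topology euclidean T') euclidean (\<lambda>p. g (case p of (c, x) \<Rightarrow> smul c x))"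
      by (rule continuous_map_eq[OF c]) (auto simp: top g_def coord_scale)
    show "(case p of (c, x) \<Rightarrow> smul c x) \<in> topspace T" if "p \<in> topspace (prod_topology euclidean T')" for p
      using that subspace_T by (auto simp: top subspace_scale)
  qed
  have g0: "g 0 = 0" using coord_scale[of 0 0] subspace_0[OF subspace_T] by (simp add: g_def)
  have convex: "\<exists>V. openin T' V \<and> 0 \<in> V \<and> V \<subseteq> U \<and> convex_wrt smul V" if U: "openin T' U" "0 \<in> U" for U
  proof -
    obtain W where W: "open W" "U = g -` W \<inter> topspace T"
      using U unfolding T'_def openin_pullback_topology by auto
    then have "0 \<in> W" using U g0 by auto
    then obtain r where r: "0 < r" "ball 0 r \<subseteq> W" using W open_contains_ball by metis
    define V where "V = g -` ball 0 r \<inter> topspace T"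
    have "openin T' V" unfolding V_def T'_def openin_pullback_topology by auto
    moreover have "0 \<in> V" using r g0 subspace_0[OF subspace_T] by (simp add: V_def)
    moreover have "V \<subseteq> U" using r W by (auto simp: V_def)
    moreover have "convex_wrt smul V"
      unfolding convex_wrt_def
    proof (intro ballI allI impI)
      fix x y and t :: real assume xy: "x \<in> V" "y \<in> V" and t: "0 \<le> t \<and> t \<le> 1"
      have xyT: "smul (of_real (1 - t)) x \<in> topspace T" "smul (of_real t) y \<in> topspace T"
        using xy subspace_T by (auto simp: V_def subspace_scale)
      have "g (smul (of_real (1 - t)) x + smul (of_real t) y) = (1 - t) *\<^sub>R g x + t *\<^sub>R g y"
        using xy xyT by (simp add: V_def g_def coord_add coord_scale scaleR_conv_of_real)
      moreover have "(1 - t) *\<^sub>R g x + t *\<^sub>R g y \<in> ball 0 r"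
        using convex_ball[of "0::'k" r] xy t unfolding convex_alt V_def by auto
      ultimately show "smul (of_real (1 - t)) x + smul (of_real t) y \<in> V"
        using xyT subspace_T by (simp add: V_def subspace_add)
    qed
    ultimately show ?thesis by blast
  qed
  have "admissible_topology smul F T'"
    unfolding admissible_topology_def locally_convex_space_def topological_vector_space_def top
  proof (intro conjI allI impI)
    show "continuous_map (F m) T' (\<lambda>x. x)" for m
      using coord_continuous_step[of m j] by (intro into_T') (auto simp: g_def topspace_T)
  qed (use topspace_T subspace_T add scale convex in auto)
  then have fin: "openin T U" if "openin T' U" for U using finest that by blast
  show ?thesis
    unfolding continuous_map_def
  proof (intro conjI allI impI)
    fix U :: "'k set" assume "openin euclidean U"
    from fin[OF openin_continuous_map_preimage[OF g this]]
    show "openin T {x \<in> topspace T. coord x j \<in> U}" by (simp add: top g_def)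
  qed simp
qed

end


section \<open>From hypercyclicity to a thick set\<close>

locale lf_shift = lf_basis smul F T e N
  for smul :: "'k::{real_normed_field, euclidean_space} \<Rightarrow> 'a::ab_group_add \<Rightarrow> 'a"
    and F T e N +
  fixes B :: "'a \<Rightarrow> 'a"
  assumes shift: "associated_backward_shift smul T e B"
begin

lemma step_T: "x \<in> topspace (F m) \<Longrightarrow> x \<in> topspace T"
  using topspace_T by blast

lemma T_mem [simp, intro]:
  "0 \<in> topspace T" "x \<in> topspace T \<Longrightarrow> y \<in> topspace T \<Longrightarrow> x + y \<in> topspace T"
  "x \<in> topspace T \<Longrightarrow> smul c x \<in> topspace T" "e j \<in> topspace T"
  using subspace_T step_T[OF step.e_mem] by (auto intro: subspace_0 subspace_add subspace_scale)

lemma T_sum [intro]: "(\<And>i. i \<in> A \<Longrightarrow> g i \<in> topspace T) \<Longrightarrow> sum g A \<in> topspace T"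
  using subspace_T by (rule subspace_sum)

lemma B_power_continuous: "continuous_map T T (B ^^ n)"
proof (induction n)
  case (Suc n)
  have "continuous_map T T B"
    using shift unfolding associated_backward_shift_def continuous_linear_operator_def by blast
  from continuous_map_compose[OF Suc this] show ?case by (simp add: comp_def)
qed (simp add: id_def)

lemma B_power_mem [simp, intro]: "x \<in> topspace T \<Longrightarrow> (B ^^ n) x \<in> topspace T"
  using B_power_continuous[of n] unfolding continuous_map_def by auto

lemma B_power_add:
  "x \<in> topspace T \<Longrightarrow> y \<in> topspace T \<Longrightarrow> (B ^^ n) (x + y) = (B ^^ n) x + (B ^^ n) y"
  using shift unfolding associated_backward_shift_def continuous_linear_operator_def
  by (induction n) auto

lemma B_power_scale: "x \<in> topspace T \<Longrightarrow> (B ^^ n) (smul c x) = smul c ((B ^^ n) x)"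
  using shift unfolding associated_backward_shift_def continuous_linear_operator_def
  by (induction n) auto

lemma B_power_0: "(B ^^ n) 0 = 0"
  using B_power_scale[of 0 n 0] by simp

lemma B_power_sum:
  "(\<And>i. i \<in> A \<Longrightarrow> g i \<in> topspace T) \<Longrightarrow> (B ^^ n) (sum g A) = (\<Sum>i\<in>A. (B ^^ n) (g i))"
  by (induction A rule: infinite_finite_induct) (auto simp: B_power_0 B_power_add T_sum)

lemma B_power_e: "(B ^^ n) (e j) = (if n \<le> j then e (j - n) else 0)"
proof (induction n)
  case (Suc n)
  have B: "B (e 0) = 0" "B (e (Suc i)) = e i" for i
    using shift unfolding associated_backward_shift_def by auto
  consider "Suc n \<le> j" | "n = j" | "j < n" by linarith
  then show ?case
  proof cases
    case 1
    then have "j - n = Suc (j - Suc n)" by simp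
    then show ?thesis using Suc 1 B by simp
  qed (use Suc B B_power_0[of 1] in auto)
qed simp

lemma B_power_psum: "(B ^^ n) (psum c k) = psum (\<lambda>j. c (n + j)) (k - n)"
proof (induction k)
  case (Suc k)
  have "(B ^^ n) (psum c (Suc k)) = (B ^^ n) (psum c k) + smul (c k) ((B ^^ n) (e k))"
    using T_sum[of "{..<k}" "\<lambda>j. smul (c j) (e j)"] by (simp add: B_power_add B_power_scale)
  then show ?case using Suc by (cases "n \<le> k") (auto simp: B_power_e Suc_diff_le)
qed (simp add: B_power_0)

lemma coord_B_power:
  assumes "x \<in> topspace T"
  shows "coord ((B ^^ n) x) j = coord x (n + j)"
proof -
  obtain m where "x \<in> topspace (F m)" using assms topspace_T by auto
  then have "limitin T (psum (coord x)) x sequentially"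
    using coord_limit limit_T by blast
  from continuous_map_limit[OF coord_continuous[of j] continuous_map_limit[OF B_power_continuous[of n] this]]
  have "(\<lambda>k. coord ((B ^^ n) (psum (coord x) k)) j) \<longlonglongrightarrow> coord ((B ^^ n) x) j"
    by (simp add: comp_def)
  moreover have "\<forall>\<^sub>F k in sequentially. coord ((B ^^ n) (psum (coord x) k)) j = coord x (n + j)"
    by (intro eventually_sequentiallyI[of "Suc (n + j)"]) (simp add: B_power_psum coord_psum)
  then have "(\<lambda>k. coord ((B ^^ n) (psum (coord x) k)) j) \<longlonglongrightarrow> coord x (n + j)"
    by (rule tendsto_eventually)
  ultimately show ?thesis by (rule LIMSEQ_unique)
qed

text \<open>
  The indices at which a hypercyclic vector has a coordinate of modulus at least 1/2 form the thick
  set.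
\<close>

theorem hypercyclic_imp_thick:
  assumes "hypercyclic T B"
  shows "\<exists>m I. thick I \<and> limitin (F m) e 0 (inf sequentially (principal I))"
proof -
  obtain x where x: "x \<in> topspace T" and dense: "T closure_of (orbit_of B x) = topspace T"
    using assms unfolding hypercyclic_def dense_in_def by blast
  obtain m where m: "x \<in> topspace (F m)" using x topspace_T by auto
  define I where "I = {j. 1/2 \<le> norm (coord x j)}"
  have "thick I"
    unfolding thick_def
  proof
    fix p
    \<comment> \<open>Vectors whose first \<open>p + 1\<close> coordinates are close to 1; the orbit meets this open set.\<close>
    define U where "U = topspace T \<inter> (\<Inter>j\<in>{..p}. {y \<in> topspace T. coord y j \<in> ball 1 (1/2)})"
    have "openin T {y \<in> topspace T. coord y j \<in> ball 1 (1/2)}" for j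
      by (rule openin_continuous_map_preimage[OF coord_continuous]) simp
    then have "openin T U"
      unfolding U_def by (intro openin_Int openin_Inter openin_topspace) blast+
    define y where "y = psum (\<lambda>_. 1) (Suc p)"
    have coord_y: "coord y = (\<lambda>j. if j < Suc p then 1 else 0)"
      unfolding y_def by (rule coord_psum)
    have y: "y \<in> topspace T" unfolding y_def by (intro T_sum) auto
    then have "y \<in> U" unfolding U_def by (auto simp: coord_y)
    moreover have "y \<in> T closure_of orbit_of B x" unfolding dense by (rule y)
    ultimately obtain z where "z \<in> U" "z \<in> orbit_of B x"
      using \<open>openin T U\<close> unfolding in_closure_of by blast
    then obtain n where n: "(B ^^ n) x \<in> U" unfolding orbit_of_def by auto
    have "n + j \<in> I" if "j \<le> p" for j
    proof -
      have "norm (1 - coord x (n + j)) < 1/2"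
        using n that x unfolding U_def by (auto simp: coord_B_power dist_norm)
      moreover have "norm (1::'k) \<le> norm (coord x (n + j)) + norm (1 - coord x (n + j))"
        using norm_triangle_ineq[of "coord x (n + j)" "1 - coord x (n + j)"] by simp
      ultimately show ?thesis unfolding I_def by simp
    qed
    then have "i \<in> I" if "n \<le> i" "i \<le> n + p" for i
      using that le_add_diff_inverse[of n i] by (metis add_le_cancel_left)
    then have "{n..n + p} \<subseteq> I" by auto
    then show "\<exists>j. {j..j + p} \<subseteq> I" by blast
  qed
  moreover have "limitin (F m) e 0 (inf sequentially (principal I))"
    unfolding step_limit
  proof (intro conjI)
    define a where "a j = smul (coord x j) (e j)" for j
    have lim: "(\<lambda>n. N m (psum (coord x) n - x)) \<longlonglongrightarrow> 0"
      using coord_limit[OF m] by (simp add: step_limit)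
    have "N m (a j) \<le> N m (psum (coord x) (Suc j) - x) + N m (psum (coord x) j - x)" for j
    proof -
      have eq: "a j = (psum (coord x) (Suc j) - x) - (psum (coord x) j - x)"
        by (simp add: a_def)
      show ?thesis unfolding eq by (rule step.f_diff) (use m in auto)
    qed
    then have "(\<lambda>j. N m (a j)) \<longlonglongrightarrow> 0"
      by (intro Lim_null_comparison[OF _ tendsto_add_zero[OF LIMSEQ_Suc[OF lim] lim]])
        (use step.f_nonneg in auto)
    then have a_small: "\<forall>\<^sub>F j in sequentially. N m (a j) < \<delta>" if "0 < \<delta>" for \<delta>
      using order_tendstoD(2) that by blast
    show "((\<lambda>j. N m (e j - 0)) \<longlongrightarrow> 0) (inf sequentially (principal I))"
    proof (rule step.f_tendsto_0I)
      fix b :: real assume "0 < b"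
      from step.scale_bounded[OF this, where K = 2 and m = m] obtain \<delta> where \<delta>: "0 < \<delta>"
        and *: "\<And>c y. y \<in> topspace (F m) \<Longrightarrow> norm c \<le> 2 \<Longrightarrow> N m y < \<delta> \<Longrightarrow> N m (smul c y) < b" by metis
      have "N m (e j) < b" if "N m (a j) < \<delta>" "j \<in> I" for j
      proof -
        have j: "1/2 \<le> norm (coord x j)" "coord x j \<noteq> 0" using that by (auto simp: I_def)
        then have "norm (inverse (coord x j)) \<le> 2"
          using le_imp_inverse_le[OF j(1)] by (simp add: norm_inverse)
        from *[OF _ this that(1)] show ?thesis using j by (simp add: a_def)
      qed
      then show "\<forall>\<^sub>F j in inf sequentially (principal I). N m (e j - 0) < b"
        unfolding eventually_inf_principal using a_small[OF \<delta>] by (auto elim!: eventually_mono)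
    qed
  qed auto
  ultimately show ?thesis by blast
qed

section \<open>From a thick set to sequential hypercyclicity\<close>

text \<open>The vector with coordinates \<open>l\<close> at the consecutive positions \<open>n, n + 1, \<dots>\<close>, and 0 elsewhere.\<close>

definition block :: "'k list \<Rightarrow> nat \<Rightarrow> 'a" where
  "block l n = (\<Sum>j<length l. smul (l ! j) (e (j + n)))"

lemma block_mem [simp, intro]: "block l n \<in> topspace (F m)" "block l n \<in> topspace T"
proof -
  show "block l n \<in> topspace (F m)" for m unfolding block_def by auto
  then show "block l n \<in> topspace T" using step_T by blast
qed

lemma B_power_block:
  "n \<le> k \<Longrightarrow> (B ^^ n) (block l k) = block l (k - n)"
  "k + length l \<le> n \<Longrightarrow> (B ^^ n) (block l k) = 0"
  unfolding block_def by (auto simp: B_power_sum B_power_scale B_power_e)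

lemma block_dense:
  assumes D: "\<And>U. open U \<Longrightarrow> U \<noteq> {} \<Longrightarrow> \<exists>d\<in>D. d \<in> U"
    and y: "y \<in> topspace (F m)" and "0 < \<epsilon>"
  shows "\<exists>l\<in>lists D. N m (block l 0 - y) < \<epsilon>"
proof -
  define c where "c = coord y"
  have half: "0 < \<epsilon>/2" using \<open>0 < \<epsilon>\<close> by simp
  have "(\<lambda>n. N m (psum c n - y)) \<longlonglongrightarrow> 0"
    using coord_limit[OF y] by (simp add: step_limit c_def)
  from eventually_happens'[OF sequentially_bot order_tendstoD(2)[OF this half]]
  obtain n where n: "N m (psum c n - y) < \<epsilon>/2" by blast
  define \<epsilon>' where "\<epsilon>' = \<epsilon> / 2 / real (Suc n)"
  have \<epsilon>': "0 < \<epsilon>'" "real n * \<epsilon>' \<le> \<epsilon> / 2" using \<open>0 < \<epsilon>\<close> by (auto simp: \<epsilon>'_def field_simps)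
  have "\<exists>d\<in>D. N m (smul (d - c j) (e j)) < \<epsilon>'" for j
  proof -
    obtain r where r: "0 < r" "\<And>a. norm a < r \<Longrightarrow> N m (smul a (e j)) < \<epsilon>'"
      using step.f_scale_vec[OF step.e_mem \<epsilon>'(1)] by metis
    obtain d where "d \<in> D" "d \<in> ball (c j) r" using D[of "ball (c j) r"] r(1) by auto
    then show ?thesis using r(2)[of "d - c j"] by (auto simp: dist_norm norm_minus_commute)
  qed
  then obtain d where d: "\<And>j. d j \<in> D" "\<And>j. N m (smul (d j - c j) (e j)) < \<epsilon>'" by metis
  define l where "l = map d [0..<n]"
  have block: "block l 0 = psum d n" by (simp add: block_def l_def)
  have "N m (psum d n - psum c n) = N m (\<Sum>j<n. smul (d j - c j) (e j))"
    by (simp add: sum_subtractf scale_left_diff_distrib)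
  also have "\<dots> \<le> (\<Sum>j<n. N m (smul (d j - c j) (e j)))" by (rule step.f_sum) auto
  also have "\<dots> \<le> (\<Sum>j<n. \<epsilon>')" by (intro sum_mono less_imp_le d)
  also have "\<dots> \<le> \<epsilon>/2" using \<epsilon>' by simp
  finally have "N m (psum d n - psum c n) \<le> \<epsilon>/2" .
  moreover have "N m (psum d n - y) \<le> N m (psum d n - psum c n) + N m (psum c n - y)"
    by (rule step.f_triangle) (use y in auto)
  ultimately have "N m (block l 0 - y) < \<epsilon>" using n unfolding block by linarith
  moreover have "l \<in> lists D" using d by (auto simp: l_def)
  ultimately show ?thesis by blast
qed

text \<open>
  The only place where thickness is used: \<open>n\<close> can be chosen such that the block at \<open>n\<close> remains small
  under all backward shifts by at most \<open>R\<close>. For this, the whole range of positions swept by the shifted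
  block has to lie far out in \<open>I\<close>.
\<close>

lemma block_small:
  assumes I: "thick I" and lim: "limitin (F m) e 0 (inf sequentially (principal I))" and "0 < \<epsilon>"
  shows "\<exists>n\<ge>R. \<forall>s\<le>R. N m (block l (n - s)) < \<epsilon>"
proof -
  define \<epsilon>' where "\<epsilon>' = \<epsilon> / real (Suc (length l))"
  have \<epsilon>': "0 < \<epsilon>'" "real (length l) * \<epsilon>' < \<epsilon>" using \<open>0 < \<epsilon>\<close> by (auto simp: \<epsilon>'_def field_simps)
  define K where "K = (\<Sum>j<length l. norm (l ! j))"
  have K: "norm (l ! j) \<le> K" if "j < length l" for j
    unfolding K_def using that by (intro member_le_sum) auto
  from step.scale_bounded[OF \<epsilon>'(1), where K = K and m = m] obtain \<delta> where \<delta>: "0 < \<delta>"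
    and *: "\<And>c y. y \<in> topspace (F m) \<Longrightarrow> norm c \<le> K \<Longrightarrow> N m y < \<delta> \<Longrightarrow> N m (smul c y) < \<epsilon>'" by metis
  have "((\<lambda>j. N m (e j)) \<longlongrightarrow> 0) (inf sequentially (principal I))"
    using lim by (simp add: step_limit)
  from order_tendstoD(2)[OF this \<delta>]
  obtain j0 where j0: "\<And>j. j \<ge> j0 \<Longrightarrow> j \<in> I \<Longrightarrow> N m (e j) < \<delta>"
    unfolding eventually_inf_principal eventually_sequentially by blast
  \<comment> \<open>The summand \<open>j0\<close> allows for starting at \<open>i + j0 \<ge> j0\<close>, as thickness gives no lower bound on \<open>i\<close>.\<close>
  obtain i where i: "{i..i + (j0 + R + length l)} \<subseteq> I" using I unfolding thick_def by blast
  define n where "n = i + j0 + R"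
  have "N m (block l (n - s)) < \<epsilon>" if "s \<le> R" for s
  proof -
    have "N m (smul (l ! j) (e (j + (n - s)))) < \<epsilon>'" if "j < length l" for j
    proof (rule *)
      have "j + (n - s) \<in> {i..i + (j0 + R + length l)}"
        using that \<open>s \<le> R\<close> by (auto simp: n_def)
      then show "N m (e (j + (n - s))) < \<delta>"
        using i \<open>s \<le> R\<close> by (intro j0) (auto simp: n_def)
    qed (use K that in auto)
    then have "(\<Sum>j<length l. N m (smul (l ! j) (e (j + (n - s))))) \<le> (\<Sum>j<length l. \<epsilon>')"
      by (intro sum_mono less_imp_le) auto
    moreover have "N m (block l (n - s)) \<le> (\<Sum>j<length l. N m (smul (l ! j) (e (j + (n - s)))))"
      unfolding block_def by (rule step.f_sum) auto
    ultimately show ?thesis using \<epsilon>' by simp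
  qed
  then show ?thesis by (intro exI[of _ n]) (auto simp: n_def)
qed

text \<open>
  For a prescribed sequence of blocks \<open>Y k\<close>, the vector \<open>x\<close> is the sum of the \<open>Y k\<close> placed at
  positions \<open>n k\<close>. Shifting by \<open>n k\<close> annihilates the earlier blocks, moves \<open>Y k\<close> to the origin, and
  keeps the later blocks small in the same step \<open>F m\<close>.
\<close>

lemma approximating_orbit:
  assumes I: "thick I" and lim: "limitin (F m) e 0 (inf sequentially (principal I))"
  obtains x n r where "x \<in> topspace T" "\<And>k. (B ^^ n k) x = block (Y k) 0 + r k"
    "\<And>k. r k \<in> topspace (F m)" "\<And>k. N m (r k) \<le> (1/2) ^ k"
proof -
  have pos: "0 < (1/2::real) ^ k" for k by simp
  have "\<exists>n. \<forall>k. N m (block (Y k) (n k)) \<le> (1/2) ^ k \<and>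
      (n k + length (Y k) \<le> n (Suc k) \<and>
       (\<forall>s\<le>n k. N m (block (Y (Suc k)) (n (Suc k) - s)) \<le> (1/2) ^ Suc k))"
  proof (rule dependent_nat_choice)
    show "\<exists>n. N m (block (Y 0) n) \<le> (1/2) ^ 0"
      using block_small[OF I lim pos[of 0], of 0 "Y 0"] by (auto intro: less_imp_le)
    fix a k
    obtain n' where n': "n' \<ge> a + length (Y k)"
      "\<And>s. s \<le> a + length (Y k) \<Longrightarrow> N m (block (Y (Suc k)) (n' - s)) < (1/2) ^ Suc k"
      using block_small[OF I lim pos[of "Suc k"], of "a + length (Y k)" "Y (Suc k)"] by blast
    then show "\<exists>n'. N m (block (Y (Suc k)) n') \<le> (1/2) ^ Suc k \<and>
        (a + length (Y k) \<le> n' \<and> (\<forall>s\<le>a. N m (block (Y (Suc k)) (n' - s)) \<le> (1/2) ^ Suc k))"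
      using n'(2)[of 0] by (intro exI[of _ n']) (auto intro!: less_imp_le)
  qed
  then obtain n where n_small: "\<And>k. N m (block (Y k) (n k)) \<le> (1/2) ^ k"
    and n_Suc: "\<And>k. n k + length (Y k) \<le> n (Suc k)"
    and n_back: "\<And>k s. s \<le> n k \<Longrightarrow> N m (block (Y (Suc k)) (n (Suc k) - s)) \<le> (1/2) ^ Suc k"
    by metis
  have n_mono: "n i \<le> n k" if "i \<le> k" for i k
    using that by (rule lift_Suc_mono_le[of n, rotated]) (use n_Suc add_leD1 in blast)
  have n_less: "n i + length (Y i) \<le> n k" if "i < k" for i k
    using n_Suc[of i] n_mono[of "Suc i" k] that by simp
  have later_small: "N m (block (Y k) (n k - n i)) \<le> (1/2) ^ k" if "i < k" for i k
    using n_back[of "n i" "k - 1"] n_mono[of i "k - 1"] that by (cases k) auto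
  define S where "S M = (\<Sum>i<M. block (Y i) (n i))" for M
  have "N m (block (Y i) (n i)) \<le> 1 * (1/2) ^ i" for i using n_small by simp
  from step.geometric_series[of _ m, OF block_mem(1) this]
  obtain x where x: "x \<in> topspace (F m)" "\<And>M. N m (S M - x) \<le> 2 * 1 * (1/2) ^ M"
    unfolding S_def by blast
  have SF: "S M \<in> topspace (F m)" for M unfolding S_def by auto
  have null: "(\<lambda>k. C * (1/2::real) ^ k) \<longlonglongrightarrow> 0" for C
    by (intro tendsto_mult_right_zero LIMSEQ_realpow_zero) auto
  have S_lim: "(\<lambda>M. N m (S M - x)) \<longlonglongrightarrow> 0"
    by (rule Lim_null_comparison[OF _ null[of "2 * 1"]]) (use x(2) step.f_nonneg in auto)
  have "\<exists>r\<in>topspace (F m). (B ^^ n k) x = block (Y k) 0 + r \<and> N m r \<le> (1/2) ^ k" for k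
  proof -
    define a where "a i = block (Y (Suc k + i)) (n (Suc k + i) - n k)" for i
    have aF: "a i \<in> topspace (F m)" for i by (simp add: a_def)
    have "N m (a i) \<le> (1/2) ^ Suc k * (1/2) ^ i" for i
      using later_small[of k "Suc k + i"] by (simp add: a_def power_add)
    from step.geometric_series[of _ m, OF aF this]
    obtain r where r: "r \<in> topspace (F m)"
      "\<And>M. N m ((\<Sum>i<M. a i) - r) \<le> 2 * (1/2) ^ Suc k * (1/2) ^ M" by blast
    \<comment> \<open>The shift is computed on finite sums and the limit is taken in \<open>T\<close>, because \<open>B\<close> need not map the
      step \<open>F m\<close> into itself.\<close>
    have shifted: "(B ^^ n k) (S (Suc k + M)) = block (Y k) 0 + (\<Sum>i<M. a i)" for M
    proof (induction M)
      case 0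
      have "(B ^^ n k) (S (Suc k)) = (\<Sum>i<Suc k. (B ^^ n k) (block (Y i) (n i)))"
        unfolding S_def by (rule B_power_sum) auto
      also have "\<dots> = (\<Sum>i<k. (B ^^ n k) (block (Y i) (n i))) + block (Y k) 0"
        by (simp add: B_power_block)
      also have "(\<Sum>i<k. (B ^^ n k) (block (Y i) (n i))) = 0"
        by (intro sum.neutral) (auto intro!: B_power_block(2) n_less)
      finally show ?case by simp
    next
      case (Suc M)
      have "(B ^^ n k) (S (Suc k + Suc M))
          = (B ^^ n k) (S (Suc k + M)) + (B ^^ n k) (block (Y (Suc k + M)) (n (Suc k + M)))"
        using step_T[OF SF[of "Suc k + M"]] by (simp add: S_def B_power_add)
      also have "(B ^^ n k) (block (Y (Suc k + M)) (n (Suc k + M))) = a M"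
        unfolding a_def by (intro B_power_block(1) n_mono) simp
      finally show ?case using Suc by (simp add: add.assoc)
    qed
    have "limitin T (\<lambda>M. S (M + Suc k)) x sequentially"
      using x SF LIMSEQ_ignore_initial_segment[OF S_lim, of "Suc k"]
      by (intro limit_T[of m]) (simp add: step_limit)
    from continuous_map_limit[OF B_power_continuous[of "n k"] this]
    have 1: "limitin T (\<lambda>M. block (Y k) 0 + (\<Sum>i<M. a i)) ((B ^^ n k) x) sequentially"
      unfolding shifted[symmetric] by (simp add: comp_def add.commute)
    have "(\<lambda>M. N m ((\<Sum>i<M. a i) - r)) \<longlonglongrightarrow> 0"
      by (rule Lim_null_comparison[OF _ null[of "2 * (1/2) ^ Suc k"]]) (use r(2) step.f_nonneg in auto)
    then have 2: "limitin T (\<lambda>M. block (Y k) 0 + (\<Sum>i<M. a i)) (block (Y k) 0 + r) sequentially"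
      using r(1) aF by (intro limit_T[of m]) (auto simp: step_limit step.mem_sum)
    have "(B ^^ n k) x = block (Y k) 0 + r"
      by (rule limitin_Hausdorff_unique[OF 1 2 _ Hausdorff_T]) simp
    moreover have "N m r \<le> (1/2) ^ k" using r(2)[of 0] by (simp add: step.f_minus)
    ultimately show ?thesis using r(1) by blast
  qed
  then obtain r where "\<And>k. r k \<in> topspace (F m)" "\<And>k. (B ^^ n k) x = block (Y k) 0 + r k"
    "\<And>k. N m (r k) \<le> (1/2) ^ k" by metis
  then show ?thesis using that step_T[OF x(1)] by blast
qed

theorem thick_imp_sequentially_hypercyclic:
  assumes I: "thick I" and lim: "limitin (F m) e 0 (inf sequentially (principal I))"
  shows "sequentially_hypercyclic T B"
proof -
  obtain D :: "'k set" where D: "countable D" "\<And>U. open U \<Longrightarrow> U \<noteq> {} \<Longrightarrow> \<exists>d\<in>D. d \<in> U"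
    using countable_dense_setE by blast
  define g where "g = from_nat_into (lists D)"
  have g: "range g = lists D"
    unfolding g_def using D(1) by (intro range_from_nat_into) auto
  \<comment> \<open>The pairing makes every list over \<open>D\<close> occur in \<open>Y\<close> at arbitrarily large indices.\<close>
  define Y where "Y k = g (fst (prod_decode k))" for k
  obtain x n r where x: "x \<in> topspace T" and orbit: "\<And>k. (B ^^ n k) x = block (Y k) 0 + r k"
    and r: "\<And>k. r k \<in> topspace (F m)" "\<And>k. N m (r k) \<le> (1/2) ^ k"
    using approximating_orbit[OF I lim, of Y] by metis
  have null: "(\<lambda>k. (1/2::real) ^ k) \<longlonglongrightarrow> 0" by (rule LIMSEQ_realpow_zero) auto
  have "(\<lambda>k. N m (r k)) \<longlonglongrightarrow> 0"
    by (rule Lim_null_comparison[OF _ null]) (use r(2) step.f_nonneg in auto)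
  then have r_lim: "limitin (F m) r 0 sequentially" using r by (simp add: step_limit)
  have "\<exists>s. (\<forall>i. s i \<in> orbit_of B x) \<and> limitin T s y sequentially" if y: "y \<in> topspace T" for y
  proof -
    obtain m' where m': "y \<in> topspace (F m')" using y topspace_T by auto
    define M where "M = max m m'"
    have yM: "y \<in> topspace (F M)" using m' step_mono[of m' M] by (auto simp: M_def)
    have rM: "limitin (F M) r 0 sequentially" using r_lim limit_mono[of m M] by (simp add: M_def)
    have rF: "r k \<in> topspace (F M)" for k using r step_mono[of m M] by (auto simp: M_def)
    have "\<exists>a. N M (block (g a) 0 - y) < (1/2) ^ i" for i :: nat
      using block_dense[OF D(2) yM, of "(1/2) ^ i"] unfolding g[symmetric] by auto
    then obtain a where a: "\<And>i. N M (block (g (a i)) 0 - y) < (1/2) ^ i" by metis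
    \<comment> \<open>The list \<open>g (a i)\<close> at an index \<open>k i \<ge> i\<close>, so that the error \<open>r (k i)\<close> tends to 0.\<close>
    define k where "k i = prod_encode (a i, i)" for i
    have k: "i \<le> k i" for i unfolding k_def by (rule le_prod_encode_2)
    then have k_lim: "filterlim k at_top sequentially"
      by (intro filterlim_at_top_mono[OF filterlim_ident]) auto
    define s where "s i = (B ^^ n (k i)) x" for i
    have s: "s i = block (g (a i)) 0 + r (k i)" for i
      unfolding s_def orbit Y_def k_def by simp
    have le: "N M (s i - y) \<le> (1/2) ^ i + N M (r (k i))" for i
    proof -
      have eq: "s i - y = (block (g (a i)) 0 - y) + r (k i)" unfolding s by simp
      have "N M (s i - y) \<le> N M (block (g (a i)) 0 - y) + N M (r (k i))"
        unfolding eq by (rule step.f_add) (use yM rF in auto)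
      then show ?thesis using a[of i] by linarith
    qed
    have "(\<lambda>k. N M (r k)) \<longlonglongrightarrow> 0" using rM by (simp add: step_limit)
    from tendsto_add_zero[OF null filterlim_compose[OF this k_lim]]
    have "(\<lambda>i. N M (s i - y)) \<longlonglongrightarrow> 0"
      by (rule Lim_null_comparison[rotated])
        (use le step.f_nonneg in auto)
    moreover have "s i \<in> topspace (F M)" for i unfolding s using rF by auto
    ultimately have "limitin T s y sequentially"
      using yM by (intro limit_T[of M]) (simp add: step_limit)
    moreover have "s i \<in> orbit_of B x" for i unfolding s_def orbit_of_def by blast
    ultimately show ?thesis by blast
  qed
  moreover have "orbit_of B x \<subseteq> topspace T" using x by (auto simp: orbit_of_def)
  ultimately show ?thesis
    using x unfolding sequentially_hypercyclic_def sequentially_dense_in_def by blast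
qed

end

section \<open>The equivalence\<close>

lemma sequentially_hypercyclic_imp_hypercyclic:
  assumes "sequentially_hypercyclic T A"
  shows "hypercyclic T A"
proof -
  obtain x where x: "x \<in> topspace T" "orbit_of A x \<subseteq> topspace T"
    and lim: "\<And>y. y \<in> topspace T \<Longrightarrow>
      \<exists>s::nat \<Rightarrow> 'a. (\<forall>n. s n \<in> orbit_of A x) \<and> limitin T s y sequentially"
    using assms unfolding sequentially_hypercyclic_def sequentially_dense_in_def by blast
  have "y \<in> T closure_of orbit_of A x" if y: "y \<in> topspace T" for y
  proof -
    obtain s where s: "\<And>n::nat. s n \<in> orbit_of A x" "limitin T s y sequentially"
      using lim[OF y] by blast
    have "\<exists>z\<in>orbit_of A x. z \<in> U" if "openin T U" "y \<in> U" for U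
      using s eventually_happens'[OF sequentially_bot] that unfolding limitin_def by metis
    then show ?thesis using y unfolding in_closure_of by blast
  qed
  then have "T closure_of orbit_of A x = topspace T"
    using closure_of_subset_topspace[of T "orbit_of A x"] by blast
  then show ?thesis using x unfolding hypercyclic_def dense_in_def by blast
qed

theorem proposition2p7:
  fixes smul :: "'k::{real_normed_field, euclidean_space} \<Rightarrow> 'a::ab_group_add \<Rightarrow> 'a"
    and F :: "nat \<Rightarrow> 'a topology"
    and T :: "'a topology"
    and e :: "nat \<Rightarrow> 'a"
    and B :: "'a \<Rightarrow> 'a"
  assumes "vector_space smul"
    and "lf_space smul F T"
    and "stepwise_schauder_basis smul F e"
    and "associated_backward_shift smul T e B"
  shows "(sequentially_hypercyclic T B \<longleftrightarrow> hypercyclic T B) \<and>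
         (hypercyclic T B \<longleftrightarrow>
           (\<exists>m I. thick I \<and> limitin (F m) e 0 (inf sequentially (principal I))))"
proof -
  have "\<exists>f. f_basis smul (topspace (F m)) f e \<and>
      F m = Metric_space.mtopology (topspace (F m)) (\<lambda>x y. f (x - y))" for m
  proof -
    have "frechet_space smul (F m)"
      using assms(2) unfolding lf_space_def inductive_spectrum_def by blast
    then obtain f where f: "f_space smul (topspace (F m)) f"
      and top: "F m = Metric_space.mtopology (topspace (F m)) (\<lambda>x y. f (x - y))"
      using frechet_f_space[OF assms(1)] by blast
    interpret f_space smul "topspace (F m)" f by (rule f)
    have sb: "schauder_basis smul (F m) e"
      using assms(3) unfolding stepwise_schauder_basis_def by blast
    then have e: "e j \<in> topspace (F m)" for j unfolding schauder_basis_def by blast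
    have "limitin (F m) (\<lambda>n. \<Sum>j<n. smul (c j) (e j)) x sequentially \<longleftrightarrow>
        (\<lambda>n. f ((\<Sum>j<n. smul (c j) (e j)) - x)) \<longlonglongrightarrow> 0" if "x \<in> topspace (F m)" for c x
      using limitin_iff[of "\<lambda>n. \<Sum>j<n. smul (c j) (e j)" x sequentially] that e
      unfolding top[symmetric] by (simp add: mem_sum)
    then have "f_basis smul (topspace (F m)) f e"
      using sb e unfolding schauder_basis_def by unfold_locales auto
    with top show ?thesis by blast
  qed
  then obtain N where N: "\<And>m. f_basis smul (topspace (F m)) (N m) e"
    "\<And>m. F m = Metric_space.mtopology (topspace (F m)) (\<lambda>x y. N m (x - y))" by metis
  interpret lf_shift smul F T e N B
    by (intro lf_shift.intro lf_basis.intro lf_basis_axioms.intro lf_shift_axioms.intro assms N)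
  show ?thesis
    using sequentially_hypercyclic_imp_hypercyclic hypercyclic_imp_thick
      thick_imp_sequentially_hypercyclic by blast
qed

end
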